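(* Let $\boldsymbol\lambda\in\mathcal P^{\ell}$. For each $w\in\widehat{\mathbf W}_\ell$ with $\mathbf r^w\in\overline{\mathcal A}_e^{\ell}$, let $\mathbf{mv}_e((\boldsymbol\lambda;\mathbf r)^w)=(m^w_1,\dots,m^w_\ell)$. The following statements are equivalent: (1) $\boldsymbol\lambda$ is decomposable (in the sense of Fayers); (2) there exist $w\in\widehat{\mathbf W}_\ell$ with $\mathbf r^w\in\overline{\mathcal A}_e^{\ell}$ and distinct $i,j\in[1,\ell]$ such that $m^w_i=m^w_j=0$; (3) for all $w\in\widehat{\mathbf W}_\ell$ with $\mathbf r^w\in\overline{\mathcal A}_e^{\ell}$, there exist distinct $i,j\in[1,\ell]$ such that $m^w_i=m^w_j=0$.
   Context: Throughout $e\ge 2$, $\ell\ge 1$ are fixed integers and $\mathbf r=(r_1,\dots,r_\ell)\in\mathbb Z^\ell$ is fixed. $[a,b]$ is the set of integers $x$ with $a\le x\le b$; $\mathbb Z/m\mathbb Z$ is identified with $[0,m-1]$; $\mathbf x^{\sigma}=(x_{\sigma(1)},\dots,x_{\sigma(m)})$ for an $m$-tuple $\mathbf x$ and $\sigma\in\mathfrak S_m$ (permutations composed right to left). $\beta$-sets. A $\beta$-set is a subset $\mathsf B\subseteq\mathbb Z$ such that $\max(\mathsf B)$ and $\min(\mathbb Z\setminus\mathsf B)$ exist; its charge is $\mathrm{ch}(\mathsf B)=|\mathsf B\cap\mathbb Z_{\ge0}|-|\mathbb Z_{<0}\setminus\mathsf B|$. Let $\mathcal P$ be the set of partitions and $\beta_t(\lambda)=\{\lambda_i+t-i\mid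 i\ge1\}$; $(\lambda,t)\mapsto\beta_t(\lambda)$ is a bijection from $\mathcal P\times\mathbb Z$ to $\beta$-sets, with $\mathrm{ch}(\beta_t(\lambda))=t$; $\beta^{-1}(\mathsf B)$ denotes the partition $\lambda$ with $\beta_{\mathrm{ch}(\mathsf B)}(\lambda)=\mathsf B$. The $e$-quotient is $\mathrm{quot}_e(\mathsf B)=(\mathsf B_1,\dots,\mathsf B_e)$ with $\mathsf B_{i+1}=\{a\in\mathbb Z\mid ae+i\in\mathsf B\}$ ($0\le i<e$). The $e$-core $\mathrm{core}_e(\mathsf B)$ is the $\beta$-set with $e$-quotient $(\mathbb Z_{<\mathrm{ch}(\mathsf B_1)},\dots,\mathbb Z_{<\mathrm{ch}(\mathsf B_e)})$ and $\mathrm{wt}_e(\mathsf B)=\sum_{i=1}^e|\beta^{-1}(\mathsf B_i)|$. For a partition, $\mathrm{wt}_e(\lambda)=\mathrm{wt}_e(\beta_t(\lambda))$ (independent of $t$). Multipartitions. For $\boldsymbol\lambda\in\mathcal P^\ell$ and $\mathbf t\in\mathbb Z^\ell$ put $\beta_{\mathbf t}(\boldsymbol\lambda)=(\beta_{t_1}(\lambda^{(1)}),\dots,\beta_{t_\ell}(\lambda^{(\ell)}))$; $\mathcal P^\ell(n)$ is the set of $\boldsymbol\lambda\in\mathcal P^\ell$ of total size $n$. Nodes of $\boldsymbol\lambda$ are triples $(a,b,i)$ of positive integers with $b\le\lambda^{(i)}_a$; the $(m,\mathbf t)$-residue of a node is $b-a+t_i$ mod $m$ (likewise for $e$-partitions).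 Uglov map. $\upsilon_i(ae+b)=ae\ell+(\ell-i)e+b$ for $a\in\mathbb Z$, $0\le b<e$, $i\in[1,\ell]$; $\mathbf U(\mathsf B^{(1)},\dots,\mathsf B^{(\ell)})=\bigcup_{i=1}^{\ell}\upsilon_i(\mathsf B^{(i)})$. Put $\mathrm{core}_e(\boldsymbol\lambda;\mathbf t)=\mathrm{core}_e(\mathbf U(\beta_{\mathbf t}(\boldsymbol\lambda)))$ and $\mathrm{wt}_e(\boldsymbol\lambda;\mathbf t)=\mathrm{wt}_e(\mathbf U(\beta_{\mathbf t}(\boldsymbol\lambda)))$. The bijection $\iota_{\ell,e}:\mathcal P^\ell\times\mathbb Z^\ell\to\mathcal P^e\times\mathbb Z^e$ is defined by $\iota_{\ell,e}(\boldsymbol\lambda;\mathbf t)=(\boldsymbol\mu;\mathbf u)$ iff $\mathrm{quot}_e(\mathbf U(\beta_{\mathbf t}(\boldsymbol\lambda)))=\beta_{\mathbf u}(\boldsymbol\mu)$. The $e$-moving vector is $\mathbf{mv}_e(\boldsymbol\lambda;\mathbf t)=(C_{\ell-1},\dots,C_0)$, where $C_i$ is the number of nodes of $\boldsymbol\mu$ with $(\ell,\mathbf u)$-residue $i$. Group action. $\widehat{\mathbf W}_m=\mathfrak S_m\ltimes\mathbb Z^m$ with $(\sigma\mathbf t)(\tau\mathbf u)=(\sigma\tau)(\mathbf t^\tau+\mathbf u)$. $\widehat{\mathbf W}_\ell$ acts on the right by $\mathbf t^{\sigma\mathbf u}=\mathbf t^\sigma+e\mathbf u$, $\boldsymbol\lambda^{\sigma\mathbf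 u}=\boldsymbol\lambda^\sigma$, $(\boldsymbol\lambda;\mathbf t)^w=(\boldsymbol\lambda^w;\mathbf t^w)$. $\overline{\mathcal A}_e^{\ell}=\{\mathbf a\in\mathbb Z^\ell\mid a_1\le\dots\le a_\ell\le a_1+e\}$. Blocks. $\boldsymbol\lambda$ of size $n$ lies in a block $B$ of the Ariki–Koike algebra $\mathcal H_{\mathbb F,q,\mathbf r}(n)$ (quantum characteristic $e$) if its Specht module does; known: $\boldsymbol\lambda,\boldsymbol\mu\in\mathcal P^\ell$ lie in the same block iff the partitions $\beta^{-1}(\mathrm{core}_e((\cdot;\mathbf r)^w))$ and the weights $\mathrm{wt}_e((\cdot;\mathbf r)^w)$ agree, for any $w$ with $\mathbf r^w\in\overline{\mathcal A}_e^\ell$ (independent of such $w$). A block is a core block if every $\boldsymbol\lambda$ lying in it satisfies $\mathrm{wt}_e(\lambda^{(i)})=0$ for all $i$. Weight graph and decomposability. For $\boldsymbol\lambda$ lying in a core block, the weight graph $G(\boldsymbol\lambda)$ has vertex set $\{1,\dots,\ell\}$, no loops, and for $i\ne j$ the number of undirected edges between $i$ and $j$ is $\mathrm{wt}_e\bigl(((\lambda^{(i)},\lambda^{(j)});(r_i,r_j))^{x}\bigr)$ computed with $\ell$ replaced by $2$, for any $x\in\widehat{\mathbf W}_2$ with $(r_i,r_j)^x\in\overline{\mathcal A}_e^2$. By Fayers, a multipartition lying in a core block is indecomposable iff $G(\boldsymbol\lambda)$ is connected; accordingly, "$\boldsymbol\lambda$ is decomposable" means that $\boldsymbol\lambda$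 lies in a core block and $G(\boldsymbol\lambda)$ is disconnected. *)

theory Defs
  imports
    "HOL-Combinatorics.Permutations"
    "HOL-Library.FuncSet"
    "Graph_Theory.Digraph_Component"
begin

text \<open>
  An \<open>m\<close>-tuple is a function on \<open>nat\<close> of which only the values on \<open>{1..m}\<close> are ever used.
\<close>

text \<open>
  The parts of a partition are numbered from 1.  The meaningless value at 0 is fixed to be 0, so
  that equality of functions is equality of partitions.
\<close>

definition is_partition :: "(nat \<Rightarrow> nat) \<Rightarrow> bool" where
  "is_partition lam \<longleftrightarrow>
     lam 0 = 0 \<and> (\<forall>i\<ge>1. lam (i + 1) \<le> lam i) \<and> finite {i. lam i \<noteq> 0}"

definition psize :: "(nat \<Rightarrow> nat) \<Rightarrow> nat" where
  "psize lam = (\<Sum>i | lam i \<noteq> 0. lam i)"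

definition is_beta_set :: "int set \<Rightarrow> bool" where
  "is_beta_set B \<longleftrightarrow>
     (\<exists>m\<in>B. \<forall>x\<in>B. x \<le> m) \<and> (\<exists>m\<in>- B. \<forall>x\<in>- B. m \<le> x)"

definition charge :: "int set \<Rightarrow> int" where
  "charge B = int (card (B \<inter> {0..})) - int (card ({..<0} - B))"

definition beta :: "int \<Rightarrow> (nat \<Rightarrow> nat) \<Rightarrow> int set" where
  "beta t lam = {int (lam i) + t - int i | i. 1 \<le> i}"

definition beta_inv :: "int set \<Rightarrow> nat \<Rightarrow> nat" where
  "beta_inv B = (THE lam. is_partition lam \<and> beta (charge B) lam = B)"

definition quot :: "nat \<Rightarrow> int set \<Rightarrow> nat \<Rightarrow> int set" where
  "quot e B i = {a. a * int e + (int i - 1) \<in> B}"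

definition core :: "nat \<Rightarrow> int set \<Rightarrow> int set" where
  "core e B =
     (THE C. is_beta_set C \<and> (\<forall>i\<in>{1..e}. quot e C i = {..<charge (quot e B i)}))"

definition wt :: "nat \<Rightarrow> int set \<Rightarrow> nat" where
  "wt e B = (\<Sum>i=1..e. psize (beta_inv (quot e B i)))"

text \<open>The choice of charge 0 is immaterial.\<close>

definition wt_partition :: "nat \<Rightarrow> (nat \<Rightarrow> nat) \<Rightarrow> nat" where
  "wt_partition e lam = wt e (beta 0 lam)"

definition is_multipartition :: "nat \<Rightarrow> (nat \<Rightarrow> nat \<Rightarrow> nat) \<Rightarrow> bool" where
  "is_multipartition l lam \<longleftrightarrow> (\<forall>i\<in>{1..l}. is_partition (lam i))"

definition mbeta :: "(nat \<Rightarrow> int) \<Rightarrow> (nat \<Rightarrow> nat \<Rightarrow> nat) \<Rightarrow> nat \<Rightarrow> int set" where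
  "mbeta t lam = (\<lambda>i. beta (t i) (lam i))"

definition nodes :: "nat \<Rightarrow> (nat \<Rightarrow> nat \<Rightarrow> nat) \<Rightarrow> (nat \<times> nat \<times> nat) set" where
  "nodes l lam = {(a, b, i). 1 \<le> a \<and> 1 \<le> b \<and> i \<in> {1..l} \<and> b \<le> lam i a}"

fun residue :: "nat \<Rightarrow> (nat \<Rightarrow> int) \<Rightarrow> nat \<times> nat \<times> nat \<Rightarrow> int" where
  "residue m t (a, b, i) = (int b - int a + t i) mod int m"

definition upsilon :: "nat \<Rightarrow> nat \<Rightarrow> nat \<Rightarrow> int \<Rightarrow> int" where
  "upsilon l e i x =
     (x div int e) * int e * int l + (int l - int i) * int e + x mod int e"

definition Uglov :: "nat \<Rightarrow> nat \<Rightarrow> (nat \<Rightarrow> int set) \<Rightarrow> int set" where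
  "Uglov l e B = (\<Union>i\<in>{1..l}. upsilon l e i ` B i)"

definition mcore ::
  "nat \<Rightarrow> nat \<Rightarrow> (nat \<Rightarrow> nat \<Rightarrow> nat) \<Rightarrow> (nat \<Rightarrow> int) \<Rightarrow> int set" where
  "mcore l e lam t = core e (Uglov l e (mbeta t lam))"

definition mwt :: "nat \<Rightarrow> nat \<Rightarrow> (nat \<Rightarrow> nat \<Rightarrow> nat) \<Rightarrow> (nat \<Rightarrow> int) \<Rightarrow> nat" where
  "mwt l e lam t = wt e (Uglov l e (mbeta t lam))"

text \<open>
  Since \<open>\<beta>\<^sub>t(\<lambda>)\<close> has charge \<open>t\<close>, the pair \<open>(\<mu>, u)\<close> below is the one satisfying
  \<open>quot e (Uglov l e (mbeta t lam)) i = mbeta u \<mu> i\<close> for all \<open>i \<in> {1..e}\<close>.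
\<close>

definition iota ::
  "nat \<Rightarrow> nat \<Rightarrow> (nat \<Rightarrow> nat \<Rightarrow> nat) \<times> (nat \<Rightarrow> int)
     \<Rightarrow> (nat \<Rightarrow> nat \<Rightarrow> nat) \<times> (nat \<Rightarrow> int)" where
  "iota l e = (\<lambda>(lam, t).
     let Q = quot e (Uglov l e (mbeta t lam))
     in (\<lambda>i. beta_inv (Q i), \<lambda>i. charge (Q i)))"

text \<open>The moving vector lists the residue counts as \<open>(C\<^bsub>l-1\<^esub>, \<dots>, C\<^sub>0)\<close>, so entry \<open>k\<close> counts residue \<open>l - k\<close>.\<close>

definition mv ::
  "nat \<Rightarrow> nat \<Rightarrow> (nat \<Rightarrow> nat \<Rightarrow> nat) \<times> (nat \<Rightarrow> int) \<Rightarrow> nat \<Rightarrow> nat" where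
  "mv l e p k =
     (let (mu, u) = iota l e p
      in card {x \<in> nodes e mu. residue l u x = int l - int k})"

text \<open>
  The pair \<open>(\<sigma>, u)\<close> is the element \<open>\<sigma>u\<close> of the extended affine Weyl group; permutations and
  integer vectors are normalised outside \<open>{1..m}\<close>.
\<close>

type_synonym waff = "(nat \<Rightarrow> nat) \<times> (nat \<Rightarrow> int)"

definition W_hat :: "nat \<Rightarrow> waff set" where
  "W_hat m = {sigma. sigma permutes {1..m}} \<times> ({1..m} \<rightarrow>\<^sub>E UNIV)"

fun act ::
  "nat \<Rightarrow> (nat \<Rightarrow> nat \<Rightarrow> nat) \<times> (nat \<Rightarrow> int) \<Rightarrow> waff
     \<Rightarrow> (nat \<Rightarrow> nat \<Rightarrow> nat) \<times> (nat \<Rightarrow> int)" where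
  "act e (lam, t) (sigma, u) =
     (\<lambda>i. lam (sigma i), \<lambda>i. t (sigma i) + int e * u i)"

fun act_charge :: "nat \<Rightarrow> (nat \<Rightarrow> int) \<Rightarrow> waff \<Rightarrow> nat \<Rightarrow> int" where
  "act_charge e t (sigma, u) = (\<lambda>i. t (sigma i) + int e * u i)"

definition A_bar :: "nat \<Rightarrow> nat \<Rightarrow> (nat \<Rightarrow> int) set" where
  "A_bar e l = {a. mono_on {1..l} a \<and> a l \<le> a 1 + int e}"

text \<open>
  A block of an Ariki--Koike algebra of quantum characteristic \<open>e\<close> and multicharge \<open>r\<close> is
  represented by the set of multipartitions whose Specht modules lie in it; \<open>block l e r lam\<close> is
  the one containing \<open>lam\<close>.  The algebra itself is not constructed: two multipartitions lie in the
  same block iff, after moving \<open>r\<close> into \<open>A_bar e l\<close>, they have the same \<open>e\<close>-core and the same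
  \<open>e\<close>-weight.  This condition does not depend on the choice of \<open>w\<close>.
\<close>

definition block ::
  "nat \<Rightarrow> nat \<Rightarrow> (nat \<Rightarrow> int) \<Rightarrow> (nat \<Rightarrow> nat \<Rightarrow> nat) \<Rightarrow> (nat \<Rightarrow> nat \<Rightarrow> nat) set" where
  "block l e r lam =
     {mu. is_multipartition l mu \<and>
        (\<forall>w\<in>W_hat l. act_charge e r w \<in> A_bar e l \<longrightarrow>
           beta_inv (case_prod (mcore l e) (act e (mu, r) w)) =
             beta_inv (case_prod (mcore l e) (act e (lam, r) w)) \<and>
           case_prod (mwt l e) (act e (mu, r) w) =
             case_prod (mwt l e) (act e (lam, r) w))}"

definition is_core_block :: "nat \<Rightarrow> nat \<Rightarrow> (nat \<Rightarrow> nat \<Rightarrow> nat) set \<Rightarrow> bool" where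
  "is_core_block l e B \<longleftrightarrow> (\<forall>mu\<in>B. \<forall>i\<in>{1..l}. wt_partition e (mu i) = 0)"

definition pair_tuple :: "'a \<Rightarrow> 'a \<Rightarrow> nat \<Rightarrow> 'a" where
  "pair_tuple x y k = (if k = 1 then x else y)"

text \<open>The weight below is the same for every admissible \<open>x\<close>; one of them is chosen.\<close>

definition edge_number ::
  "nat \<Rightarrow> (nat \<Rightarrow> int) \<Rightarrow> (nat \<Rightarrow> nat \<Rightarrow> nat) \<Rightarrow> nat \<Rightarrow> nat \<Rightarrow> nat" where
  "edge_number e r lam i j =
     (let rr = pair_tuple (r i) (r j);
          x = (SOME x. x \<in> W_hat 2 \<and> act_charge e rr x \<in> A_bar e 2)
      in case_prod (mwt 2 e) (act e (pair_tuple (lam i) (lam j), rr) x))"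

text \<open>
  An undirected multigraph: the \<open>k\<close>-th edge between \<open>i\<close> and \<open>j\<close> is the single arc \<open>(i, j, k)\<close> with
  \<open>i < j\<close>, whose orientation is ignored by the predicate \<open>connected\<close>.
\<close>

definition weight_graph ::
  "nat \<Rightarrow> nat \<Rightarrow> (nat \<Rightarrow> int) \<Rightarrow> (nat \<Rightarrow> nat \<Rightarrow> nat)
     \<Rightarrow> (nat, nat \<times> nat \<times> nat) pre_digraph" where
  "weight_graph l e r lam =
     \<lparr> verts = {1..l},
       arcs = {(i, j, k). 1 \<le> i \<and> i < j \<and> j \<le> l \<and> k < edge_number e r lam i j},
       tail = (\<lambda>(i, j, k). i),
       head = (\<lambda>(i, j, k). j) \<rparr>"

definition decomposable ::
  "nat \<Rightarrow> nat \<Rightarrow> (nat \<Rightarrow> int) \<Rightarrow> (nat \<Rightarrow> nat \<Rightarrow> nat) \<Rightarrow> bool" where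
  "decomposable l e r lam \<longleftrightarrow>
     is_core_block l e (block l e r lam) \<and> \<not> connected (weight_graph l e r lam)"

end

theory Submission
  imports Defs
begin

text \<open>
Put \<open>(\<mu>, t) = (\<lambda>, r)\<^sup>w\<close> with \<open>t\<close> in the closed alcove, and let \<open>U\<close> be the beta-set that the Uglov map
attaches to \<open>(\<mu>, t)\<close>.  For every integer \<open>j\<close> the \<open>j\<close>-th strand of \<open>U\<close> is a beta-set \<open>X\<^sub>j\<close>: the strands
\<open>X\<^sub>1, \<dots>, X\<^sub>l\<close> are the beta-sets of the components of \<open>\<mu>\<close>, and \<open>X\<^bsub>j+l\<^esub> = X\<^sub>j + e\<close>.  The charges of the strands
weakly increase with \<open>j\<close>; this is what membership in the closed alcove means.

\<^item> A node of the \<open>e\<close>-quotient whose residue belongs to entry \<open>i\<close> of the moving vector corresponds to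
a bead that moves from \<open>X\<^bsub>i+1\<^esub>\<close> to the same place in \<open>X\<^sub>i\<close>, which adds an \<open>e\<close>-hook to \<open>U\<close>.  Hence entry \<open>i\<close>
vanishes iff \<open>X\<^sub>j \<subseteq> X\<^sub>k\<close> whenever \<open>j \<le> i < k\<close> (\<open>no_moves_iff\<close>).

\<^item> For \<open>i < j < i + l\<close> the vertices carried by \<open>X\<^sub>i\<close> and \<open>X\<^sub>j\<close> are not joined in the weight graph iff
\<open>X\<^sub>i \<subseteq> X\<^sub>j \<subseteq> X\<^bsub>i+l\<^esub>\<close>.  Because of the charges this says only that every translate of \<open>X\<^sub>i\<close> by a multiple
of \<open>e\<close> is comparable with \<open>X\<^sub>j\<close>, a condition that does not see the choices of \<open>w\<close> and of the alcove
representative of the pair (\<open>edge_number_eq_0_iff\<close>).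

\<^item> For a fixed multicharge the core and the weight determine the moving vector, and lying in one block
can be expressed by two invariants that do not depend on \<open>w\<close> (\<open>core_wt_act_eq_iff\<close>).

Two zeros imply decomposability.  A zero at \<open>i\<close> gives \<open>X\<^sub>j \<subseteq> X\<^bsub>j+l\<^esub> = X\<^sub>j + e\<close>, so all components are
\<open>e\<close>-cores; the moving vector is constant on the block, so the block is a core block.  Zeros at \<open>i < j\<close>
put every strand with index in \<open>{i+1..j}\<close> and every other strand into the nested position above, so
the weight graph is disconnected.

Decomposability implies two zeros, for every \<open>w\<close>.  A core block has some zero
(\<open>core_block_imp_separated\<close>): if all entries are positive, then, as the charges increase, there is
another beta-set with the same core whose moving vector is smaller by one in each entry
(\<open>lower_moves\<close>); moving its largest bead up by \<open>e\<close> inside its strand restores the moving vector and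
yields a member of the block with a component that is not a core.  Given a zero at \<open>i\<close>, split the
vertices of the disconnected graph into two nonempty sides without edges between them, and let \<open>X\<^sub>k\<close> be
the first strand after \<open>X\<^bsub>i+1\<^esub>\<close> whose vertex lies on the other side.  Were the cut at \<open>k - 1\<close> not a zero,
two strands before and after it, within the window of length \<open>l\<close> that starts at \<open>i + 1\<close>, would be joined
by an edge.  Both would then lie on the side of \<open>X\<^bsub>i+1\<^esub>\<close> and be nested with \<open>X\<^sub>k\<close>, and the two inclusions
compose to one that excludes the edge.

Finally, an admissible \<open>w\<close> exists, by sorting the residues of \<open>r\<close> modulo \<open>e\<close>, so the universal
statement implies the existential one.
\<close>

section \<open>Regularised sums over beta-sets\<close>

lemma is_beta_set_iff:
  "is_beta_set B \<longleftrightarrow> (\<exists>m M. {..<m} \<subseteq> B \<and> B \<subseteq> {..<M})"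
proof
  assume "is_beta_set B"
  then obtain M m where M: "\<forall>x\<in>B. x \<le> M" and m: "\<forall>x\<in>- B. m \<le> x"
    unfolding is_beta_set_def by blast
  have "{..<m} \<subseteq> B" using m by force
  moreover have "B \<subseteq> {..<M + 1}" using M by force
  ultimately show "\<exists>m M. {..<m} \<subseteq> B \<and> B \<subseteq> {..<M}" by blast
next
  assume "\<exists>m M. {..<m} \<subseteq> B \<and> B \<subseteq> {..<M}"
  then obtain m M where m: "{..<m} \<subseteq> B" and M: "B \<subseteq> {..<M}" by blast
  have mM: "m \<le> M"
    using m M by (metis lessThan_subset_iff subset_trans)
  have below: "m - 1 \<in> B" and above: "M \<notin> B" using m M by auto
  have fin1: "finite (B \<inter> {m - 1..M})" and fin2: "finite (- B \<inter> {m - 1..M})" by auto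
  have ne1: "B \<inter> {m - 1..M} \<noteq> {}" and ne2: "- B \<inter> {m - 1..M} \<noteq> {}"
    using below above mM by auto
  have "\<forall>x\<in>B. x \<le> Max (B \<inter> {m - 1..M})"
  proof
    fix x assume x: "x \<in> B"
    show "x \<le> Max (B \<inter> {m - 1..M})"
    proof (cases "m - 1 \<le> x")
      case True
      then show ?thesis using x M fin1 by (intro Max_ge) auto
    next
      case False
      have "m - 1 \<le> Max (B \<inter> {m - 1..M})" using fin1 below mM by (intro Max_ge) auto
      then show ?thesis using False by linarith
    qed
  qed
  moreover have "\<forall>x\<in>- B. Min (- B \<inter> {m - 1..M}) \<le> x"
  proof
    fix x assume x: "x \<in> - B"
    show "Min (- B \<inter> {m - 1..M}) \<le> x"
    proof (cases "x \<le> M")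
      case True
      have "m \<le> x" using x m by force
      then show ?thesis using x fin2 True by (intro Min_le) auto
    next
      case False
      have "Min (- B \<inter> {m - 1..M}) \<le> M" using fin2 above mM by (intro Min_le) auto
      then show ?thesis using False by linarith
    qed
  qed
  ultimately show "is_beta_set B"
    unfolding is_beta_set_def using Max_in[OF fin1 ne1] Min_in[OF fin2 ne2] by blast
qed

lemma is_beta_set_lessThan [simp]: "is_beta_set {..<n}"
  unfolding is_beta_set_iff by blast

lemma is_beta_set_vimage:
  assumes B: "is_beta_set B" and h: "strict_mono (h :: int \<Rightarrow> int)"
  shows "is_beta_set (h -` B)"
proof -
  obtain m M where m: "{..<m} \<subseteq> B" and M: "B \<subseteq> {..<M}" using B is_beta_set_iff by auto
  have expand: "y - x \<le> h y - h x" if "x \<le> y" for x y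
    using that
  proof (induction y rule: int_ge_induct)
    case (step y)
    have "h y < h (y + 1)" using h by (simp add: strict_mono_def)
    then show ?case using step.IH by linarith
  qed simp
  have "h x < m" if "x < min 0 (m - h 0)" for x
    using expand[of x 0] that by linarith
  then have "{..<min 0 (m - h 0)} \<subseteq> h -` B" using m by force
  moreover have "x < max 0 (M - h 0)" if "h x < M" for x
    using expand[of 0 x] that by linarith
  then have "h -` B \<subseteq> {..<max 0 (M - h 0)}" using M by force
  ultimately show ?thesis unfolding is_beta_set_iff by blast
qed

text \<open>
  A beta-set is infinite, but it differs from the ground state \<open>{..<0}\<close> in finitely many places, so the
  difference of the two sums of \<open>f\<close> makes sense.  The charge is the case \<open>f = 1\<close>, and the size of a partition, its
  residue counts and its content counts are differences of such sums.
\<close>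

definition rsum :: "(int \<Rightarrow> int) \<Rightarrow> int set \<Rightarrow> int" where
  "rsum f B = (\<Sum>x\<in>B \<inter> {0..}. f x) - (\<Sum>x\<in>{..<0} - B. f x)"

lemma charge_eq_rsum: "charge B = rsum (\<lambda>_. 1) B"
  by (simp add: charge_def rsum_def)

lemma beta_set_finite_parts:
  assumes "is_beta_set B"
  shows "finite (B \<inter> {n..})" "finite ({..<n} - B)"
proof -
  obtain m M where m: "{..<m} \<subseteq> B" and M: "B \<subseteq> {..<M}" using assms is_beta_set_iff by auto
  have "B \<inter> {n..} \<subseteq> {n..<M}" "{..<n} - B \<subseteq> {m..<n}" using m M by force+
  then show "finite (B \<inter> {n..})" "finite ({..<n} - B)"
    using finite_subset by blast+
qed

lemma beta_set_finite_diff: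
  assumes "is_beta_set A" "is_beta_set B"
  shows "finite (A - B)"
proof -
  have "A - B \<subseteq> (A \<inter> {0..}) \<union> ({..<0} - B)" by force
  then show ?thesis
    using beta_set_finite_parts[OF assms(1)] beta_set_finite_parts[OF assms(2)] 
    by (meson finite_UnI finite_subset)
qed

lemma rsum_lessThan_0 [simp]: "rsum f {..<0} = 0"
proof -
  have "{..<0} \<inter> {0..} = ({} :: int set)" by auto
  then show ?thesis by (simp add: rsum_def)
qed

lemma rsum_add: "rsum (\<lambda>x. f x + g x) B = rsum f B + rsum g B"
  by (simp add: rsum_def sum.distrib)

lemma rsum_cmult: "rsum (\<lambda>x. c * f x) B = c * rsum f B"
  by (simp add: rsum_def sum_distrib_left algebra_simps)

lemma rsum_diff_fun: "rsum (\<lambda>x. f x - g x) B = rsum f B - rsum g B"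
  by (simp add: rsum_def sum_subtractf)

lemma rsum_const: "rsum (\<lambda>_. c) B = c * charge B"
  using rsum_cmult[of c "\<lambda>_. 1" B] by (simp add: charge_eq_rsum)

lemma rsum_cong: "(\<And>x. f x = g x) \<Longrightarrow> rsum f B = rsum g B"
  by (simp add: rsum_def)

lemma rsum_sum: "rsum (\<lambda>x. \<Sum>j\<in>J. f j x) B = (\<Sum>j\<in>J. rsum (f j) B)"
  by (simp add: rsum_def sum_subtractf sum.swap[where A = J])

text \<open>
  The reference set \<open>{..<0}\<close> cancels in a difference, so any beta-set can serve as a reference.
\<close>

lemma rsum_diff:
  assumes A: "is_beta_set A" and B: "is_beta_set B"
  shows "rsum f A - rsum f B = (\<Sum>x\<in>A - B. f x) - (\<Sum>x\<in>B - A. f x)"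
proof -
  note fA = beta_set_finite_parts[OF A, of 0] and fB = beta_set_finite_parts[OF B, of 0]
  note d = beta_set_finite_diff[OF A B] beta_set_finite_diff[OF B A]
  have split: "sum f X = sum f (X \<inter> {0..}) + sum f (X \<inter> {..<0})" if "finite X" for X :: "int set"
  proof -
    have "X = (X \<inter> {0..}) \<union> (X \<inter> {..<0})" by force
    moreover have "(X \<inter> {0..}) \<inter> (X \<inter> {..<0}) = {}" by force
    ultimately show ?thesis using that by (metis finite_Int sum.union_disjoint)
  qed
  have pos: "sum f (A \<inter> {0..}) - sum f (B \<inter> {0..})
      = sum f ((A - B) \<inter> {0..}) - sum f ((B - A) \<inter> {0..})"
  proof -
    have "sum f (A \<inter> {0..}) = sum f (A \<inter> {0..} - B \<inter> {0..}) + sum f (A \<inter> {0..} \<inter> (B \<inter> {0..}))"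
      using fA by (metis add.commute sum.Int_Diff)
    moreover have "sum f (B \<inter> {0..}) = sum f (B \<inter> {0..} - A \<inter> {0..}) + sum f (A \<inter> {0..} \<inter> (B \<inter> {0..}))"
      using fB by (metis add.commute inf_commute sum.Int_Diff)
    moreover have "A \<inter> {0..} - B \<inter> {0..} = (A - B) \<inter> {0..}" "B \<inter> {0..} - A \<inter> {0..} = (B - A) \<inter> {0..}"
      by auto
    ultimately show ?thesis by simp
  qed
  have neg: "sum f ({..<0} - B) - sum f ({..<0} - A)
      = sum f ((A - B) \<inter> {..<0}) - sum f ((B - A) \<inter> {..<0})"
  proof -
    have "sum f ({..<0} - B) = sum f (({..<0} - B) - ({..<0} - A)) + sum f (({..<0} - A) \<inter> ({..<0} - B))"
      using fB by (metis add.commute inf_commute sum.Int_Diff)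
    moreover have "sum f ({..<0} - A) = sum f (({..<0} - A) - ({..<0} - B)) + sum f (({..<0} - A) \<inter> ({..<0} - B))"
      using fA by (metis add.commute sum.Int_Diff)
    moreover have "({..<0} - B) - ({..<0} - A) = (A - B) \<inter> {..<0}"
        "({..<0} - A) - ({..<0} - B) = (B - A) \<inter> {..<0}"
      by auto
    ultimately show ?thesis by simp
  qed
  show ?thesis
    using pos neg split[OF d(1)] split[OF d(2)] unfolding rsum_def by linarith
qed

lemma rsum_add_beads:
  assumes "is_beta_set B" "B \<subseteq> A" "finite (A - B)"
  shows "rsum f A = rsum f B + (\<Sum>x\<in>A - B. f x)" "is_beta_set A"
proof -
  obtain m M where m: "{..<m} \<subseteq> B" and M: "B \<subseteq> {..<M}" using assms is_beta_set_iff by auto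
  obtain K where K: "\<forall>x\<in>A - B. x \<le> K" 
    using assms(3) bdd_above_finite bdd_above_def by metis
  have "A \<subseteq> {..<max M (K + 1)}"  using K M by force
  then show A: "is_beta_set A" unfolding is_beta_set_iff using m assms(2) by blast
  have "B - A = {}" using assms(2) by auto
  then have "sum f (B - A) = 0" by (simp only: sum.empty)
  then show "rsum f A = rsum f B + (\<Sum>x\<in>A - B. f x)"
    using rsum_diff[OF A assms(1), of f] by linarith
qed

lemma rsum_move_bead:
  assumes B: "is_beta_set B" and z: "z \<in> B" "z' \<notin> B"
  shows "rsum f (insert z' (B - {z})) = rsum f B + f z' - f z"
    and "is_beta_set (insert z' (B - {z}))"
proof -
  obtain m M where m: "{..<m} \<subseteq> B" and M: "B \<subseteq> {..<M}" using assms is_beta_set_iff by auto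
  have "{..<min m z} \<subseteq> insert z' (B - {z})" "insert z' (B - {z}) \<subseteq> {..<max M (z' + 1)}"
    using m M by force+
  then show A: "is_beta_set (insert z' (B - {z}))" unfolding is_beta_set_iff by blast
  have "insert z' (B - {z}) - B = {z'}" "B - insert z' (B - {z}) = {z}" using z by auto
  then show "rsum f (insert z' (B - {z})) = rsum f B + f z' - f z"
    using rsum_diff[OF A B, of f] by simp
qed

lemma charge_mono:
  assumes "is_beta_set A" "is_beta_set B" "A \<subseteq> B"
  shows "charge A \<le> charge B"
  using rsum_add_beads(1)[OF assms(1,3) beta_set_finite_diff[OF assms(2,1)], where f = "\<lambda>_. 1"]
  by (simp add: charge_eq_rsum)

text \<open>
  Each additional bead raises the charge by one.
\<close>

lemma subset_charge_eq:
  assumes "is_beta_set A" "is_beta_set B" "A \<subseteq> B" "charge B \<le> charge A"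
  shows "A = B"
proof -
  have "finite (B - A)" using beta_set_finite_diff assms by blast
  then have "B - A = {}"
    using rsum_add_beads(1)[OF assms(1,3), of "\<lambda>_. 1"] assms(4)
    by (simp add: charge_eq_rsum)
  then show ?thesis using assms(3) by blast
qed

definition shift :: "int \<Rightarrow> int set \<Rightarrow> int set" where
  "shift n B = {x. x - n \<in> B}"

lemma mem_shift [simp]: "x \<in> shift n B \<longleftrightarrow> x - n \<in> B"
  by (simp add: shift_def)

lemma shift_shift [simp]: "shift m (shift n B) = shift (m + n) B"
  by (auto simp: shift_def algebra_simps)

lemma shift_0 [simp]: "shift 0 B = B"
  by (simp add: shift_def)

lemma is_beta_set_shift [simp]:
  assumes "is_beta_set B"
  shows "is_beta_set (shift n B)"
proof -
  have "shift n B = (\<lambda>x. x - n) -` B" by (auto simp: shift_def)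
  then show ?thesis using is_beta_set_vimage[OF assms] by (simp add: strict_mono_def)
qed

lemma rsum_shift:
  assumes B: "is_beta_set B"
  shows "rsum f (shift n B) = rsum (\<lambda>x. f (x + n)) B + rsum f {..<n}"
proof -
  have re: "sum f (shift n X) = (\<Sum>x\<in>X. f (x + n))" for X
  proof -
    have "shift n X = (\<lambda>x. x + n) ` X"
      by (auto simp: shift_def image_iff) (metis diff_add_cancel)
    then show ?thesis by (simp add: sum.reindex inj_on_def)
  qed
  have "rsum f (shift n B) - rsum f {..<n}
      = sum f (shift n (B - {..<0})) - sum f (shift n ({..<0} - B))"
  proof -
    have "shift n B - {..<n} = shift n (B - {..<0})" "{..<n} - shift n B = shift n ({..<0} - B)"
      by auto
    then show ?thesis using rsum_diff[OF is_beta_set_shift[OF B, of n], of "{..<n}" f] by simp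
  qed
  also have "\<dots> = rsum (\<lambda>x. f (x + n)) B"
    using rsum_diff[OF B, of "{..<0}" "\<lambda>x. f (x + n)"] by (simp add: re)
  finally show ?thesis by simp
qed

lemma charge_lessThan [simp]: "charge {..<n} = n"
proof (cases "0 \<le> n")
  case True
  have "{..<n} \<inter> {0..} = {0..<n}" "{..<0} - {..<n} = {}" using True by auto
  then show ?thesis using True by (simp add: charge_def)
next
  case False
  have "{..<n} \<inter> {0..} = {}" "{..<0} - {..<n} = {n..<0}" using False by auto
  then show ?thesis using False by (simp add: charge_def)
qed

lemma charge_shift:
  assumes "is_beta_set B"
  shows "charge (shift n B) = charge B + n"
  using rsum_shift[OF assms, of "\<lambda>_. 1" n] by (simp flip: charge_eq_rsum)

text \<open>
  Runners of an abacus and strands of the Uglov map are preimages of a beta-set under injections that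
  respect the sign; the sign condition makes the ground states correspond, so no correction term appears.
\<close>

lemma rsum_vimage:
  assumes inj: "inj h" and sgn: "\<And>x. 0 \<le> h x \<longleftrightarrow> 0 \<le> (x :: int)"
    and g: "\<And>x. g (h x) = f x" and g0: "\<And>z. z \<notin> range h \<Longrightarrow> g z = 0"
    and B: "is_beta_set B"
  shows "rsum f (h -` B) = rsum g B"
proof -
  note fin = beta_set_finite_parts[OF B, of 0]
  have "sum g (B \<inter> {0..}) = sum g (h ` (h -` B \<inter> {0..}))"
  proof (intro sum.mono_neutral_right ballI)
    fix z assume "z \<in> B \<inter> {0..} - h ` (h -` B \<inter> {0..})"
    then have "z \<notin> range h" using sgn by force
    then show "g z = 0" by (rule g0)
  qed (use fin(1) sgn in auto)
  also have "\<dots> = sum f (h -` B \<inter> {0..})"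
    using inj by (subst sum.reindex) (auto simp: g intro: inj_on_subset)
  finally have 1: "sum g (B \<inter> {0..}) = sum f (h -` B \<inter> {0..})" .
  have sgn': "h x < 0 \<longleftrightarrow> x < 0" for x using sgn[of x] by linarith
  have "sum g ({..<0} - B) = sum g (h ` ({..<0} - h -` B))"
  proof (intro sum.mono_neutral_right ballI)
    fix z assume "z \<in> {..<0} - B - h ` ({..<0} - h -` B)"
    then have "z \<notin> range h" using sgn' by force
    then show "g z = 0" by (rule g0)
  qed (use fin(2) sgn' in auto)
  also have "\<dots> = sum f ({..<0} - h -` B)"
    using inj by (subst sum.reindex) (auto simp: g intro: inj_on_subset)
  finally show ?thesis using 1 by (simp add: rsum_def)
qed

lemma rsum_partition:
  assumes J: "finite J" and inj: "\<And>j. j \<in> J \<Longrightarrow> inj (h j)"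
    and sgn: "\<And>j x. j \<in> J \<Longrightarrow> 0 \<le> h j x \<longleftrightarrow> 0 \<le> (x :: int)"
    and part: "\<And>z. \<exists>!j. j \<in> J \<and> z \<in> range (h j)"
    and B: "is_beta_set B"
  shows "rsum f B = (\<Sum>j\<in>J. rsum (\<lambda>x. f (h j x)) (h j -` B))"
proof -
  have "rsum (\<lambda>x. f (h j x)) (h j -` B) = rsum (\<lambda>z. if z \<in> range (h j) then f z else 0) B"
    if "j \<in> J" for j
    by (rule rsum_vimage[OF inj[OF that] sgn[OF that] _ _ B]) simp_all
  moreover have "rsum f B = rsum (\<lambda>z. \<Sum>j\<in>J. if z \<in> range (h j) then f z else 0) B"
  proof (rule rsum_cong)
    fix z
    obtain j where j: "j \<in> J" "z \<in> range (h j)" "\<forall>k. k \<in> J \<and> z \<in> range (h k) \<longrightarrow> k = j"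
      using part[of z] unfolding Ex1_def by blast
    have "(\<Sum>k\<in>J. if z \<in> range (h k) then f z else 0) = (\<Sum>k\<in>{j}. if z \<in> range (h k) then f z else 0)"
    proof (rule sum.mono_neutral_right)
      show "\<forall>k\<in>J - {j}. (if z \<in> range (h k) then f z else 0) = 0" using j(3) by auto
    qed (use J j(1) in auto)
    then show "f z = (\<Sum>k\<in>J. if z \<in> range (h k) then f z else 0)" using j(2) by simp
  qed
  ultimately show ?thesis by (simp add: rsum_sum)
qed

section \<open>Partitions and beta-sets\<close>

lemma is_partition_antimono:
  assumes "is_partition lam" "1 \<le> i" "i \<le> j"
  shows "lam j \<le> lam i"
  using assms(3)
proof (induction j rule: dec_induct)
  case (step n)
  then show ?case using assms(1,2) unfolding is_partition_def by (metis Suc_eq_plus1 le_trans)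
qed simp

lemma is_partition_bound:
  assumes "is_partition lam"
  obtains N where "\<And>i. N < i \<Longrightarrow> lam i = 0"
proof -
  have "finite {i. lam i \<noteq> 0}" using assms by (simp add: is_partition_def)
  then obtain N where "\<forall>i\<in>{i. lam i \<noteq> 0}. i \<le> N" using finite_nat_set_iff_bounded_le by blast
  then show ?thesis using that[of N] by fastforce
qed

lemma beta_strict_antimono:
  assumes "is_partition lam" "1 \<le> i" "i < j"
  shows "int (lam j) + t - int j < int (lam i) + t - int i"
  using is_partition_antimono[OF assms(1,2), of j] assms(3) by linarith

lemma mem_beta: "x \<in> beta t lam \<longleftrightarrow> (\<exists>i\<ge>1. x = int (lam i) + t - int i)"
  by (auto simp: beta_def)

lemma beta_eq_Un_beads:
  assumes "\<And>i. N < i \<Longrightarrow> lam i = 0"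
  shows "beta t lam = {..<t - int N} \<union> (\<lambda>a. int (lam a) + t - int a) ` {1..N}"
proof (rule set_eqI)
  fix x
  have "(\<exists>i\<ge>1. x = int (lam i) + t - int i)
      \<longleftrightarrow> (\<exists>i\<ge>1. N < i \<and> x = t - int i) \<or> (\<exists>i\<in>{1..N}. x = int (lam i) + t - int i)"
    (is "?L \<longleftrightarrow> ?R1 \<or> ?R2")
  proof
    assume ?L
    then obtain i where i: "i \<ge> 1" "x = int (lam i) + t - int i" by blast
    then show "?R1 \<or> ?R2" using assms[of i] by (cases "N < i") auto
  next
    assume "?R1 \<or> ?R2"
    then show ?L using assms by fastforce
  qed
  moreover have "(\<exists>i\<ge>1. N < i \<and> x = t - int i) \<longleftrightarrow> (\<exists>i>N. x = t - int i)"
    by (intro ex_cong1) auto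
  ultimately have "x \<in> beta t lam \<longleftrightarrow> (\<exists>i>N. x = t - int i) \<or> (\<exists>i\<in>{1..N}. x = int (lam i) + t - int i)"
    unfolding mem_beta by simp
  moreover have "(\<exists>i>N. x = t - int i) \<longleftrightarrow> x < t - int N"
  proof
    assume "x < t - int N"
    then have "N < nat (t - x)" "x = t - int (nat (t - x))" by linarith+
    then show "\<exists>i>N. x = t - int i" by blast
  qed auto
  ultimately show "x \<in> beta t lam \<longleftrightarrow> x \<in> {..<t - int N} \<union> (\<lambda>a. int (lam a) + t - int a) ` {1..N}"
    by auto
qed

definition young :: "(nat \<Rightarrow> nat) \<Rightarrow> (nat \<times> nat) set" where
  "young lam = {(a, b). 1 \<le> a \<and> 1 \<le> b \<and> b \<le> lam a}"

lemma young_eq_Sigma: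
  assumes "\<And>i. N < i \<Longrightarrow> lam i = 0"
  shows "young lam = Sigma {1..N} (\<lambda>a. {1..lam a})"
proof -
  have "a \<le> N" if "1 \<le> b" "b \<le> lam a" for a b
    using that assms[of a] by (cases "N < a") auto
  then show ?thesis by (auto simp: young_def)
qed

lemma finite_young: "is_partition lam \<Longrightarrow> finite (young lam)"
proof -
  assume "is_partition lam"
  then obtain N where "\<And>i. N < i \<Longrightarrow> lam i = 0" using is_partition_bound by blast
  then show ?thesis using young_eq_Sigma[of N lam] by simp
qed

text \<open>
  The \<open>a\<close>-th bead moves from \<open>t - a\<close> to \<open>\<lambda>\<^sub>a + t - a\<close>, one step for each node of the \<open>a\<close>-th row, and the
  step for a node ends at its content; the sum of \<open>f\<close> telescopes along each row.
\<close>

lemma rsum_beta: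
  assumes "is_partition lam"
  shows "rsum f (beta t lam)
      = rsum f {..<t} + (\<Sum>(a, b)\<in>young lam. f (int b - int a + t) - f (int b - int a + t - 1))"
    and is_beta_set_beta: "is_beta_set (beta t lam)"
proof -
  obtain N where N: "\<And>i. N < i \<Longrightarrow> lam i = 0" using is_partition_bound assms by blast
  define g where "g = (\<lambda>a. int (lam a) + t - int a)"
  have g_less: "g j < g i" if "1 \<le> i" "i < j" for i j
    using beta_strict_antimono[OF assms that] by (simp add: g_def)
  have inj: "inj_on g {1..N}"
    by (rule linorder_inj_onI) (use g_less in force)+
  have eq: "beta t lam = {..<t - int N} \<union> g ` {1..N}"
    using beta_eq_Un_beads[of N lam t] N by (simp add: g_def)
  have disj: "{..<t - int N} \<inter> g ` {1..N} = {}" by (auto simp: g_def)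
  have diff: "beta t lam - {..<t - int N} = g ` {1..N}" using eq disj by blast
  have fin: "finite (beta t lam - {..<t - int N})" by (simp add: diff)
  have sub: "{..<t - int N} \<subseteq> beta t lam" using eq by blast
  show "is_beta_set (beta t lam)" by (rule rsum_add_beads(2)[OF _ sub fin]) simp
  have 1: "rsum f (beta t lam) = rsum f {..<t - int N} + (\<Sum>a=1..N. f (g a))"
    using rsum_add_beads(1)[OF _ sub fin, of f] inj by (simp add: diff sum.reindex)
  have vac: "{..<t} - {..<t - int N} = (\<lambda>a. t - int a) ` {1..N}"
  proof (rule set_eqI)
    fix x show "x \<in> {..<t} - {..<t - int N} \<longleftrightarrow> x \<in> (\<lambda>a. t - int a) ` {1..N}"
    proof
      assume "x \<in> {..<t} - {..<t - int N}"
      then have "x = t - int (nat (t - x))" "nat (t - x) \<in> {1..N}" by auto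
      then show "x \<in> (\<lambda>a. t - int a) ` {1..N}" by blast
    qed auto
  qed
  have "rsum f {..<t} = rsum f {..<t - int N} + sum f ({..<t} - {..<t - int N})"
    by (rule rsum_add_beads(1)) (auto simp: vac)
  also have "sum f ({..<t} - {..<t - int N}) = (\<Sum>a=1..N. f (t - int a))"
    unfolding vac by (subst sum.reindex) (auto simp: inj_on_def)
  finally have 2: "rsum f {..<t} = rsum f {..<t - int N} + (\<Sum>a=1..N. f (t - int a))" .
  have row: "(\<Sum>b=1..n. f (int b - int a + t) - f (int b - int a + t - 1))
      = f (int n + t - int a) - f (t - int a)" for n a
    by (induction n) (simp_all add: algebra_simps)
  have "(\<Sum>(a, b)\<in>young lam. f (int b - int a + t) - f (int b - int a + t - 1))
      = (\<Sum>a=1..N. f (g a) - f (t - int a))"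
  proof -
    have "(\<Sum>(a, b)\<in>young lam. f (int b - int a + t) - f (int b - int a + t - 1))
        = (\<Sum>a=1..N. \<Sum>b=1..lam a. f (int b - int a + t) - f (int b - int a + t - 1))"
      by (subst sum.Sigma) (simp_all add: young_eq_Sigma[of N lam] N)
    then show ?thesis by (simp only: row g_def)
  qed
  then show "rsum f (beta t lam)
      = rsum f {..<t} + (\<Sum>(a, b)\<in>young lam. f (int b - int a + t) - f (int b - int a + t - 1))"
    using 1 2 by (simp add: sum_subtractf)
qed

lemma charge_beta: "is_partition lam \<Longrightarrow> charge (beta t lam) = t"
  using rsum_beta(1)[of lam "\<lambda>_. 1" t] by (simp add: charge_lessThan flip: charge_eq_rsum)

lemma shift_beta: "shift n (beta t lam) = beta (t + n) lam"
proof (rule set_eqI)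
  fix x
  have "x - n = int (lam i) + t - int i \<longleftrightarrow> x = int (lam i) + (t + n) - int i" for i by linarith
  then show "x \<in> shift n (beta t lam) \<longleftrightarrow> x \<in> beta (t + n) lam" by (simp add: mem_beta)
qed

lemma psize_eq_card_young:
  assumes "is_partition lam"
  shows "psize lam = card (young lam)"
proof -
  obtain N where N: "\<And>i. N < i \<Longrightarrow> lam i = 0" using is_partition_bound assms by blast
  have "lam i \<noteq> 0 \<Longrightarrow> i \<in> {1..N}" for i
    using N[of i] assms by (cases "i = 0") (auto simp: is_partition_def not_less[symmetric])
  then have "psize lam = (\<Sum>a=1..N. lam a)"
    unfolding psize_def by (intro sum.mono_neutral_left) auto
  then show ?thesis by (simp add: young_eq_Sigma[OF N])
qed

text \<open>
  The parts are recovered from the beads in decreasing order: at the first row where two partitions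
  differ, the larger part gives a bead that the other beta-set skips.
\<close>

lemma beta_inject:
  assumes lam: "is_partition lam" and mu: "is_partition mu" and eq: "beta t lam = beta t mu"
  shows "lam = mu"
proof -
  have no: "\<not> mu' i < lam' i"
    if lam': "is_partition lam'" and mu': "is_partition mu'" and sub: "beta t lam' \<subseteq> beta t mu'"
      and i: "1 \<le> i" and less: "\<And>j. 1 \<le> j \<Longrightarrow> j < i \<Longrightarrow> lam' j = mu' j"
    for lam' mu' :: "nat \<Rightarrow> nat" and i
  proof
    assume a: "mu' i < lam' i"
    have "int (lam' i) + t - int i \<in> beta t mu'" using sub i mem_beta by blast
    then obtain j where j: "1 \<le> j" "int (lam' i) + t - int i = int (mu' j) + t - int j"
      using mem_beta by auto
    show False
    proof (cases "j < i")
      case True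
      then show False using beta_strict_antimono[OF lam' j(1) True, of t] less[OF j(1) True] j(2) by simp
    next
      case False
      then show False using is_partition_antimono[OF mu' i, of j] j(2) a by simp
    qed
  qed
  have "lam i = mu i" for i
  proof (induction i rule: less_induct)
    case (less i)
    show ?case
    proof (cases "i = 0")
      case True
      then show ?thesis using lam mu by (simp add: is_partition_def)
    next
      case False
      have "\<not> mu i < lam i" by (rule no[OF lam mu]) (use eq False less in auto)
      moreover have "\<not> lam i < mu i" by (rule no[OF mu lam]) (use eq False less in auto)
      ultimately show ?thesis by simp
    qed
  qed
  then show ?thesis by blast
qed

text \<open>
  Induction on the largest bead: a new largest bead is a new first row, and the remaining beads
  describe the other rows with charge one less.
\<close>

lemma ex_partition_beads:
  assumes "finite F" "F \<subseteq> {n..}"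
  shows "\<exists>lam. is_partition lam \<and> beta (n + int (card F)) lam = {..<n} \<union> F"
  using assms
proof (induction F rule: finite_linorder_max_induct)
  case empty
  have "beta n (\<lambda>_. 0) = {..<n}" using beta_eq_Un_beads[of 0 "\<lambda>_. 0" n] by simp
  then show ?case by (intro exI[of _ "\<lambda>_. 0"]) (simp add: is_partition_def)
next
  case (insert b F)
  define t where "t = n + int (card F)"
  obtain lam where lam: "is_partition lam" and eq: "beta t lam = {..<n} \<union> F"
    using insert by (auto simp: t_def)
  have b: "n \<le> b" "b \<notin> F" using insert by auto
  have "int (lam 1) + t - 1 \<in> beta t lam" unfolding mem_beta by (intro exI[of _ 1]) simp
  then have "int (lam 1) + t - 1 < b" using eq insert b by auto
  then have lam1: "int (lam 1) \<le> b - t" by simp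
  define mu where "mu = (\<lambda>i. if i = 0 then 0 else if i = 1 then nat (b - t) else lam (i - 1))"
  have "mu (i + 1) \<le> mu i" if "1 \<le> i" for i
  proof (cases "i = 1")
    case True
    then show ?thesis using lam1 by (simp add: mu_def)
  next
    case False
    then show ?thesis
      using is_partition_antimono[OF lam, of "i - 1" i] that by (simp add: mu_def)
  qed
  moreover have "finite {i. mu i \<noteq> 0}"
  proof (rule finite_subset)
    show "{i. mu i \<noteq> 0} \<subseteq> {0, 1} \<union> Suc ` {i. lam i \<noteq> 0}"
    proof
      fix i assume "i \<in> {i. mu i \<noteq> 0}"
      then show "i \<in> {0, 1} \<union> Suc ` {i. lam i \<noteq> 0}"
        by (cases i) (auto simp: mu_def split: if_splits)
    qed
    show "finite ({0, 1} \<union> Suc ` {i. lam i \<noteq> 0})" using lam by (simp add: is_partition_def)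
  qed
  ultimately have mu: "is_partition mu" by (simp add: is_partition_def mu_def)
  have "x \<in> beta (t + 1) mu \<longleftrightarrow> x = b \<or> x \<in> beta t lam" for x
  proof
    assume "x \<in> beta (t + 1) mu"
    then obtain i where i: "1 \<le> i" "x = int (mu i) + (t + 1) - int i" using mem_beta by auto
    show "x = b \<or> x \<in> beta t lam"
    proof (cases "i = 1")
      case True
      then show ?thesis using i lam1 by (simp add: mu_def)
    next
      case False
      then have "x = int (lam (i - 1)) + t - int (i - 1)" "1 \<le> i - 1"
        using i by (auto simp: mu_def)
      then show ?thesis using mem_beta by blast
    qed
  next
    assume "x = b \<or> x \<in> beta t lam"
    then show "x \<in> beta (t + 1) mu"
    proof
      assume "x = b"
      then have "x = int (mu 1) + (t + 1) - int 1" using lam1 by (simp add: mu_def)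
      then show ?thesis using mem_beta by blast
    next
      assume "x \<in> beta t lam"
      then obtain i where i: "1 \<le> i" "x = int (lam i) + t - int i" using mem_beta by auto
      then have "x = int (mu (i + 1)) + (t + 1) - int (i + 1)" "1 \<le> i + 1" by (auto simp: mu_def)
      then show ?thesis using mem_beta by blast
    qed
  qed
  then have "beta (t + 1) mu = {..<n} \<union> insert b F" using eq by blast
  moreover have "n + int (card (insert b F)) = t + 1" using insert b by (simp add: t_def)
  ultimately show ?case using mu by auto
qed

lemma
  assumes "is_beta_set B"
  shows is_partition_beta_inv: "is_partition (beta_inv B)"
    and beta_beta_inv: "beta (charge B) (beta_inv B) = B"
proof -
  obtain m where m: "{..<m} \<subseteq> B" using assms is_beta_set_iff by auto
  then obtain lam where lam: "is_partition lam"
      "beta (m + int (card (B \<inter> {m..}))) lam = {..<m} \<union> (B \<inter> {m..})"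
    using ex_partition_beads[of "B \<inter> {m..}" m] beta_set_finite_parts(1)[OF assms] by blast
  have "{..<m} \<union> (B \<inter> {m..}) = B" using m by force
  then have eq: "beta (m + int (card (B \<inter> {m..}))) lam = B" using lam by simp
  then have "m + int (card (B \<inter> {m..})) = charge B" using charge_beta[OF lam(1)] by metis
  then have "is_partition lam \<and> beta (charge B) lam = B" using lam eq by simp
  moreover have "nu = lam" if "is_partition nu \<and> beta (charge B) nu = B" for nu
    using beta_inject[of nu lam "charge B"] that calculation by simp
  ultimately have "is_partition (beta_inv B) \<and> beta (charge B) (beta_inv B) = B"
    unfolding beta_inv_def by (rule theI)
  then show "is_partition (beta_inv B)" "beta (charge B) (beta_inv B) = B" by auto
qed

lemma rsum_eq_sum_young:
  assumes "is_beta_set B"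
  shows "rsum f B = rsum f {..<charge B}
     + (\<Sum>(a, b)\<in>young (beta_inv B). f (int b - int a + charge B) - f (int b - int a + charge B - 1))"
  using rsum_beta(1)[OF is_partition_beta_inv[OF assms], of f "charge B"] beta_beta_inv[OF assms] by simp

lemma psize_beta_inv:
  assumes "is_beta_set B"
  shows "int (psize (beta_inv B)) = rsum (\<lambda>x. x) B - rsum (\<lambda>x. x) {..<charge B}"
  using rsum_eq_sum_young[OF assms, of "\<lambda>x. x"] psize_eq_card_young[OF is_partition_beta_inv[OF assms]]
  by (simp add: case_prod_unfold)

text \<open>
  The number of nodes of content \<open>c\<close> is the smaller one of the number of beads at or above \<open>c\<close> and the
  number of holes below \<open>c\<close>; the difference of the two is \<open>t - c\<close>.  So such a node exists iff some bead
  has passed some hole across \<open>c\<close>.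
\<close>

lemma card_nodes_content:
  assumes B: "is_beta_set B"
  defines "t \<equiv> charge B"
  shows "(\<exists>(a, b)\<in>young (beta_inv B). int b - int a + t = c) \<longleftrightarrow> (\<exists>x\<in>B. \<exists>y. y \<notin> B \<and> y < c \<and> c \<le> x)"
proof -
  note fin = beta_set_finite_parts[OF B, of c]
  define A where "A = {p \<in> young (beta_inv B). int (snd p) - int (fst p) + t = c}"
  have finA: "finite A" using finite_young[OF is_partition_beta_inv[OF B]] by (simp add: A_def)
  \<comment> \<open>with this indicator only the steps of the beads that end at content \<open>c\<close> contribute\<close>
  let ?f = "\<lambda>x. of_bool (c \<le> x) :: int"
  have rel: "rsum f B - rsum f {..<c} = sum f (B \<inter> {c..}) - sum f ({..<c} - B)" for f
  proof -
    have "B - {..<c} = B \<inter> {c..}" by auto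
    then show ?thesis using rsum_diff[OF B is_beta_set_lessThan, of f c] by simp
  qed
  have rel': "rsum ?f {..<t} - rsum ?f {..<c} = max 0 (t - c)"
  proof -
    have "{..<t} - {..<c} = {c..<t}" by auto
    moreover have "sum ?f ({..<c} - {..<t}) = 0" by (intro sum.neutral) auto
    ultimately show ?thesis using rsum_diff[of "{..<t}" "{..<c}" ?f] by simp
  qed
  have "(\<Sum>(a, b)\<in>young (beta_inv B). ?f (int b - int a + t) - ?f (int b - int a + t - 1))
      = (\<Sum>p\<in>young (beta_inv B). of_bool (int (snd p) - int (fst p) + t = c))"
    by (intro sum.cong) auto
  also have "\<dots> = int (card A)"
    using finite_young[OF is_partition_beta_inv[OF B]]
    by (simp add: A_def of_bool_def Int_def flip: sum.inter_filter)
  finally have "int (card A) = rsum ?f B - rsum ?f {..<t}"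
    using rsum_eq_sum_young[OF B, of ?f] by (simp add: t_def)
  also have "\<dots> = int (card (B \<inter> {c..})) - max 0 (t - c)"
  proof -
    have "sum ?f (B \<inter> {c..}) = int (card (B \<inter> {c..}))" by simp
    moreover have "sum ?f ({..<c} - B) = 0" by (intro sum.neutral) auto
    ultimately show ?thesis using rel[of ?f] rel' by linarith
  qed
  moreover have "t - c = int (card (B \<inter> {c..})) - int (card ({..<c} - B))"
    using rel[of "\<lambda>_. 1"] by (simp add: t_def flip: charge_eq_rsum)
  ultimately have "int (card A) = min (int (card (B \<inter> {c..}))) (int (card ({..<c} - B)))"
    by linarith
  then have "card A = 0 \<longleftrightarrow> card (B \<inter> {c..}) = 0 \<or> card ({..<c} - B) = 0" by linarith
  then have "A = {} \<longleftrightarrow> B \<inter> {c..} = {} \<or> {..<c} - B = {}"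
    using finA fin by (simp only: card_0_eq)
  then have "A \<noteq> {} \<longleftrightarrow> (\<exists>x\<in>B. \<exists>y. y \<notin> B \<and> y < c \<and> c \<le> x)" by auto
  moreover have "A \<noteq> {} \<longleftrightarrow> (\<exists>(a, b)\<in>young (beta_inv B). int b - int a + t = c)"
    by (simp add: A_def case_prod_unfold Bex_def)
  ultimately show ?thesis by simp
qed

section \<open>Quotients, cores and weights\<close>

text \<open>
  Runner \<open>i\<close> of the \<open>e\<close>-abacus carries the positions with residue \<open>i - 1\<close>, since runners are numbered
  from 1.
\<close>

lemma quot_eq_vimage: "quot e B i = (\<lambda>a. a * int e + (int i - 1)) -` B"
  by (auto simp: quot_def)

lemma mem_quot: "a \<in> quot e B i \<longleftrightarrow> a * int e + (int i - 1) \<in> B"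
  by (simp add: quot_def)

lemma is_beta_set_quot:
  assumes "0 < e" "is_beta_set B"
  shows "is_beta_set (quot e B i)"
  unfolding quot_eq_vimage
  by (rule is_beta_set_vimage[OF assms(2)]) (use assms(1) in \<open>simp add: strict_mono_def\<close>)

lemma div_less_iff:
  assumes "0 < (d :: int)"
  shows "z div d < n \<longleftrightarrow> z < n * d"
proof
  assume "z div d < n"
  then have "z div d * d \<le> (n - 1) * d" using assms by (intro mult_right_mono) auto
  moreover have "z = z div d * d + z mod d" "z mod d < d" using assms by auto
  ultimately show "z < n * d" unfolding left_diff_distrib by linarith
next
  assume "z < n * d"
  show "z div d < n"
  proof (rule ccontr)
    assume "\<not> z div d < n"
    then have "n * d \<le> z div d * d" using assms by (intro mult_right_mono) auto
    moreover have "z div d * d \<le> z" using assms by (simp add: minus_mod_eq_div_mult [symmetric])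
    ultimately show False using \<open>z < n * d\<close> by linarith
  qed
qed

lemma runner_div_mod:
  assumes "i \<in> {1..e}"
  shows "(a * int e + (int i - 1)) div int e = a" "(a * int e + (int i - 1)) mod int e = int i - 1"
  using assms by (auto simp: div_eq_0_iff)

lemma runner_nonneg:
  assumes "i \<in> {1..e}"
  shows "0 \<le> a * int e + (int i - 1) \<longleftrightarrow> 0 \<le> a"
  using runner_div_mod(1)[OF assms, of a] assms
  by (metis atLeastAtMost_iff less_le_trans of_nat_0_less_iff pos_imp_zdiv_nonneg_iff zero_less_one)

lemma runner_range:
  assumes "i \<in> {1..e}"
  shows "z \<in> range (\<lambda>a. a * int e + (int i - 1)) \<longleftrightarrow> z mod int e = int i - 1"
proof
  assume "z mod int e = int i - 1"
  then have "z = (z div int e) * int e + (int i - 1)" by (metis div_mult_mod_eq)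
  then show "z \<in> range (\<lambda>a. a * int e + (int i - 1))" by blast
qed (use runner_div_mod[OF assms] in auto)

lemma runner_inj: "i \<in> {1..e} \<Longrightarrow> inj (\<lambda>a. a * int e + (int i - 1))"
  by (auto intro!: injI)

lemma runner_of:
  assumes "0 < e"
  obtains i where "i \<in> {1..e}" "z mod int e = int i - 1"
  using assms by (intro that[of "nat (z mod int e) + 1"]) (auto simp: nat_less_iff Suc_le_eq)

lemma sum_rsum_quot:
  assumes e: "0 < e" and B: "is_beta_set B"
  shows "(\<Sum>i=1..e. rsum f (quot e B i)) = rsum (\<lambda>z. f (z div int e)) B"
proof -
  let ?h = "\<lambda>i a. a * int e + (int i - 1)"
  have "rsum (\<lambda>z. f (z div int e)) B = (\<Sum>i=1..e. rsum (\<lambda>x. f (?h i x div int e)) (?h i -` B))"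
  proof (rule rsum_partition[OF _ runner_inj runner_nonneg _ B])
    fix z
    obtain i where i: "i \<in> {1..e}" "z mod int e = int i - 1" using runner_of e by blast
    show "\<exists>!i. i \<in> {1..e} \<and> z \<in> range (?h i)"
    proof (rule ex1I[of _ i])
      show "i \<in> {1..e} \<and> z \<in> range (?h i)" using i runner_range by blast
      fix k assume "k \<in> {1..e} \<and> z \<in> range (?h k)"
      then have "z mod int e = int k - 1" using runner_range by blast
      then show "k = i" using i by simp
    qed
  qed simp_all
  also have "\<dots> = (\<Sum>i=1..e. rsum f (quot e B i))"
    using runner_div_mod(1) unfolding quot_eq_vimage by (intro sum.cong refl rsum_cong) simp
  finally show ?thesis by simp
qed

lemma charge_quot_eq_rsum:
  assumes "i \<in> {1..e}" "is_beta_set B"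
  shows "charge (quot e B i) = rsum (\<lambda>z. of_bool (z mod int e = int i - 1)) B"
  unfolding charge_eq_rsum quot_eq_vimage
proof (rule rsum_vimage[OF runner_inj[OF assms(1)] runner_nonneg[OF assms(1)] _ _ assms(2)])
  show "of_bool ((x * int e + (int i - 1)) mod int e = int i - 1) = (1 :: int)" for x
    using runner_div_mod(2)[OF assms(1), of x] by simp
  show "of_bool (z mod int e = int i - 1) = (0 :: int)" if "z \<notin> range (\<lambda>a. a * int e + (int i - 1))" for z
    using that runner_range[OF assms(1), of z] by simp
qed

lemma sum_charge_quot:
  assumes "0 < e" "is_beta_set B"
  shows "(\<Sum>i=1..e. charge (quot e B i)) = charge B"
  using sum_rsum_quot[OF assms, of "\<lambda>_. 1"] by (simp add: charge_eq_rsum)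

lemma quot_eqI:
  assumes e: "0 < e" and eq: "\<And>i. i \<in> {1..e} \<Longrightarrow> quot e B i = quot e C i"
  shows "B = C"
proof (rule set_eqI)
  fix z
  obtain i where i: "i \<in> {1..e}" "z mod int e = int i - 1" using runner_of e by blast
  have "z = (z div int e) * int e + (int i - 1)" using i by (metis div_mult_mod_eq)
  then show "z \<in> B \<longleftrightarrow> z \<in> C" using eq[OF i(1)] mem_quot by metis
qed

lemma
  assumes e: "0 < e" and B: "is_beta_set B"
  shows is_beta_set_core: "is_beta_set (core e B)"
    and quot_core: "\<And>i. i \<in> {1..e} \<Longrightarrow> quot e (core e B) i = {..<charge (quot e B i)}"
proof -
  define u where "u i = charge (quot e B i)" for i
  define C where "C = {z. z div int e < u (nat (z mod int e) + 1)}"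
  define L where "L = Min (u ` {1..e})"
  define H where "H = Max (u ` {1..e})"
  have LH: "L \<le> u i" "u i \<le> H" if "i \<in> {1..e}" for i
    using that by (auto simp: L_def H_def)
  have idx: "nat (z mod int e) + 1 \<in> {1..e}" for z
    using e by (auto simp: nat_less_iff Suc_le_eq)
  have "{..<L * int e} \<subseteq> C"
  proof
    fix z assume "z \<in> {..<L * int e}"
    then have "z div int e < L" using div_less_iff e by simp
    then show "z \<in> C" using LH(1)[OF idx[of z]] by (simp add: C_def)
  qed
  moreover have "C \<subseteq> {..<H * int e}"
  proof
    fix z assume "z \<in> C"
    then have "z div int e < H" using LH(2)[OF idx[of z]] by (simp add: C_def)
    then show "z \<in> {..<H * int e}" using div_less_iff e by simp
  qed
  ultimately have betaC: "is_beta_set C" unfolding is_beta_set_iff by blast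
  have quotC: "\<forall>i\<in>{1..e}. quot e C i = {..<u i}"
  proof
    fix i assume i: "i \<in> {1..e}"
    have "nat (int i - 1) + 1 = i" using i by auto
    then have "a \<in> quot e C i \<longleftrightarrow> a < u i" for a
      unfolding mem_quot C_def mem_Collect_eq runner_div_mod[OF i] by metis
    then show "quot e C i = {..<u i}" by blast
  qed
  have "is_beta_set (core e B) \<and> (\<forall>i\<in>{1..e}. quot e (core e B) i = {..<charge (quot e B i)})"
    unfolding core_def
  proof (rule theI[of "\<lambda>C. is_beta_set C \<and> (\<forall>i\<in>{1..e}. quot e C i = {..<charge (quot e B i)})"])
    show "is_beta_set C \<and> (\<forall>i\<in>{1..e}. quot e C i = {..<charge (quot e B i)})"
      using betaC quotC unfolding u_def by blast
    fix D assume "is_beta_set D \<and> (\<forall>i\<in>{1..e}. quot e D i = {..<charge (quot e B i)})"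
    then have "quot e D i = quot e C i" if "i \<in> {1..e}" for i
      using quotC that unfolding u_def by metis
    then show "D = C" by (rule quot_eqI[OF e])
  qed
  then show "is_beta_set (core e B)" "\<And>i. i \<in> {1..e} \<Longrightarrow> quot e (core e B) i = {..<charge (quot e B i)}"
    by auto
qed

lemma charge_core:
  assumes "0 < e" "is_beta_set B"
  shows "charge (core e B) = charge B"
  using sum_charge_quot[OF assms(1) is_beta_set_core[OF assms]] sum_charge_quot[OF assms] quot_core[OF assms]
  by simp

lemma rsum_core:
  assumes "0 < e" "is_beta_set B"
  shows "rsum (\<lambda>z. f (z div int e)) (core e B) = (\<Sum>i=1..e. rsum f {..<charge (quot e B i)})"
  using sum_rsum_quot[OF assms(1) is_beta_set_core[OF assms], of f] quot_core[OF assms] by simp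

lemma core_eqI:
  assumes "0 < e" "is_beta_set B" "is_beta_set C" "\<And>i. i \<in> {1..e} \<Longrightarrow> charge (quot e B i) = charge (quot e C i)"
  shows "core e B = core e C"
  by (rule quot_eqI[OF assms(1)]) (simp only: quot_core[OF assms(1,2)] quot_core[OF assms(1,3)] assms(4))

lemma core_eq_iff:
  assumes "0 < e" "is_beta_set B" "is_beta_set C"
  shows "core e B = core e C \<longleftrightarrow> (\<forall>i\<in>{1..e}. charge (quot e B i) = charge (quot e C i))"
proof
  assume eq: "core e B = core e C"
  show "\<forall>i\<in>{1..e}. charge (quot e B i) = charge (quot e C i)"
  proof
    fix i assume i: "i \<in> {1..e}"
    then have "{..<charge (quot e B i)} = {..<charge (quot e C i)}"
      using quot_core[OF assms(1,2) i] quot_core[OF assms(1,3) i] eq by simp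
    then show "charge (quot e B i) = charge (quot e C i)" by (metis charge_lessThan)
  qed
qed (use core_eqI[OF assms] in blast)

text \<open>
  Passing from a beta-set to its partition forgets only the charge, and a core is determined by the
  charges of its runners.
\<close>

lemma beta_inv_core_eq_iff:
  assumes "0 < e" "is_beta_set B" "is_beta_set C" "charge B = charge C"
  shows "beta_inv (core e B) = beta_inv (core e C)
      \<longleftrightarrow> (\<forall>i\<in>{1..e}. charge (quot e B i) = charge (quot e C i))"
proof -
  have "core e B = core e C" if "beta_inv (core e B) = beta_inv (core e C)"
    using beta_beta_inv[OF is_beta_set_core[OF assms(1,2)]] beta_beta_inv[OF is_beta_set_core[OF assms(1,3)]]
    by (simp only: charge_core[OF assms(1,2)] charge_core[OF assms(1,3)] assms(4) that)
  then show ?thesis using core_eq_iff[OF assms(1-3)] by auto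
qed

text \<open>
  The row number \<open>z div e\<close> is the position of a bead on its runner, so both terms together count the
  single steps that lead from the core to \<open>B\<close>.
\<close>

lemma wt_eq_rsum:
  assumes "0 < e" "is_beta_set B"
  shows "int (wt e B) = rsum (\<lambda>z. z div int e) B - rsum (\<lambda>z. z div int e) (core e B)"
  using psize_beta_inv[OF is_beta_set_quot[OF assms]] sum_rsum_quot[OF assms, of "\<lambda>x. x"]
    rsum_core[OF assms, of "\<lambda>x. x"]
  by (simp add: wt_def sum_subtractf)

lemma psize_beta_inv_eq_0_iff:
  assumes B: "is_beta_set B"
  shows "psize (beta_inv B) = 0 \<longleftrightarrow> (\<forall>x\<in>B. x - 1 \<in> B)"
proof
  assume "psize (beta_inv B) = 0"
  then have y: "young (beta_inv B) = {}"
    using psize_eq_card_young is_partition_beta_inv[OF B] finite_young by (metis card_eq_0_iff)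
  show "\<forall>x\<in>B. x - 1 \<in> B"
  proof
    fix x assume "x \<in> B"
    then show "x - 1 \<in> B" using card_nodes_content[OF B, of x] y by force
  qed
next
  assume down: "\<forall>x\<in>B. x - 1 \<in> B"
  have less: "y \<in> B" if "x \<in> B" "y \<le> x" for x y
    using that(2,1) by (induction y rule: int_le_induct) (use down in auto)
  have "young (beta_inv B) = {}"
  proof (rule ccontr)
    assume "young (beta_inv B) \<noteq> {}"
    then obtain a b where "(a, b) \<in> young (beta_inv B)" by fast
    then have "\<exists>(a, b)\<in>young (beta_inv B). int b - int a + charge B = int b - int a + charge B" by blast
    then have "\<exists>c. \<exists>(a, b)\<in>young (beta_inv B). int b - int a + charge B = c" by blast
    then obtain x y where "x \<in> B" "y \<notin> B" "y < x" using card_nodes_content[OF B] by fastforce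
    then show False using less by auto
  qed
  then show "psize (beta_inv B) = 0"
    using psize_eq_card_young[OF is_partition_beta_inv[OF B]] by simp
qed

lemma wt_eq_0_iff:
  assumes e: "0 < e" and B: "is_beta_set B"
  shows "wt e B = 0 \<longleftrightarrow> (\<forall>x\<in>B. x - int e \<in> B)"
proof -
  have "wt e B = 0 \<longleftrightarrow> (\<forall>i\<in>{1..e}. \<forall>a\<in>quot e B i. a - 1 \<in> quot e B i)"
    using psize_beta_inv_eq_0_iff[OF is_beta_set_quot[OF e B]] by (simp add: wt_def)
  also have "\<dots> \<longleftrightarrow> (\<forall>x\<in>B. x - int e \<in> B)"
  proof (intro iffI ballI)
    fix x assume L: "\<forall>i\<in>{1..e}. \<forall>a\<in>quot e B i. a - 1 \<in> quot e B i" and x: "x \<in> B"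
    obtain i where i: "i \<in> {1..e}" "x mod int e = int i - 1" using runner_of e by blast
    have eq: "x = (x div int e) * int e + (int i - 1)" using i by (metis div_mult_mod_eq)
    then have "x div int e \<in> quot e B i" using x by (simp add: mem_quot)
    then have "(x div int e - 1) * int e + (int i - 1) \<in> B" using L i by (simp add: mem_quot)
    moreover have "(x div int e - 1) * int e + (int i - 1) = x - int e"
      using eq by (simp add: left_diff_distrib)
    ultimately show "x - int e \<in> B" by simp
  next
    fix i a assume R: "\<forall>x\<in>B. x - int e \<in> B" and a: "a \<in> quot e B i"
    have eq: "(a - 1) * int e + (int i - 1) = a * int e + (int i - 1) - int e"
      by (simp add: left_diff_distrib)
    show "a - 1 \<in> quot e B i" using R a unfolding mem_quot eq by blast
  qed
  finally show ?thesis .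
qed

lemma wt_partition_eq_0_iff:
  assumes "0 < e" "is_partition lam"
  shows "wt_partition e lam = 0 \<longleftrightarrow> (\<forall>x\<in>beta t lam. x - int e \<in> beta t lam)"
proof -
  have eq: "x \<in> beta t lam \<longleftrightarrow> x - t \<in> beta 0 lam" for x
    using shift_beta[of t 0 lam] by (metis add_0 mem_shift)
  have "(\<forall>x\<in>beta 0 lam. x - int e \<in> beta 0 lam) \<longleftrightarrow> (\<forall>x\<in>beta t lam. x - int e \<in> beta t lam)"
  proof (intro iffI ballI)
    fix x assume a: "\<forall>x\<in>beta 0 lam. x - int e \<in> beta 0 lam" "x \<in> beta t lam"
    then have "x - t - int e \<in> beta 0 lam" using eq[of x] by blast
    moreover have "x - t - int e = x - int e - t" by simp
    ultimately show "x - int e \<in> beta t lam" using eq[of "x - int e"] by simp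
  next
    fix x assume a: "\<forall>x\<in>beta t lam. x - int e \<in> beta t lam" "x \<in> beta 0 lam"
    then have "x + t - int e \<in> beta t lam" using eq[of "x + t"] by simp
    moreover have "x + t - int e - t = x - int e" by simp
    ultimately show "x - int e \<in> beta 0 lam" using eq[of "x + t - int e"] by simp
  qed
  then show ?thesis
    unfolding wt_partition_def using wt_eq_0_iff[OF assms(1) is_beta_set_beta[OF assms(2)]] by simp
qed

section \<open>Strands of a beta-set\<close>

text \<open>
  The Uglov map for an arbitrary integer component \<open>j\<close>.  On \<open>j \<in> {1..l}\<close> it is \<open>\<upsilon>\<^sub>j\<close>; the formula still
  makes sense for other \<open>j\<close>, and this turns the \<open>l\<close> components into an affine sequence.
\<close>

definition position :: "nat \<Rightarrow> nat \<Rightarrow> int \<Rightarrow> int \<Rightarrow> int" where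
  "position e l j x = (x div int e * int l + int l - j) * int e + x mod int e"

definition strand :: "nat \<Rightarrow> nat \<Rightarrow> int set \<Rightarrow> int \<Rightarrow> int set" where
  "strand e l U j = position e l j -` U"

lemma mem_strand: "x \<in> strand e l U j \<longleftrightarrow> position e l j x \<in> U"
  by (simp add: strand_def)

lemma upsilon_eq_position: "upsilon l e i x = position e l (int i) x"
  by (simp add: upsilon_def position_def algebra_simps)

text \<open>
  Moving a bead of \<open>U\<close> up by \<open>e\<close> raises its level by one if the bead crosses from strand \<open>i + 1\<close> to strand
  \<open>i\<close> and keeps the level otherwise.
\<close>

definition cut_level :: "nat \<Rightarrow> nat \<Rightarrow> int \<Rightarrow> int \<Rightarrow> int" where
  "cut_level e l i z = (z div int e + i) div int l"

context
  fixes e l :: nat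
  assumes e: "0 < e" and l: "0 < l"
begin

lemma position_div: "position e l j x div int e = x div int e * int l + int l - j"
  and position_mod: "position e l j x mod int e = x mod int e"
  using e by (simp_all add: position_def div_eq_0_iff)

lemma position_shift: "position e l (j + int l) (x + int e) = position e l j x"
proof -
  have "(x + int e) div int e = x div int e + 1" using e by simp
  then show ?thesis by (simp add: position_def algebra_simps)
qed

lemma position_next: "position e l (j - 1) x = position e l j x + int e"
  by (simp add: position_def algebra_simps)

lemma position_row_shift: "position e l j (x + int e) = position e l j x + int e * int l"
proof -
  have "(x + int e) div int e = x div int e + 1" using e by simp
  then show ?thesis by (simp add: position_def algebra_simps)
qed

lemma strict_mono_position: "strict_mono (position e l j)"
proof (rule strict_monoI)
  fix x y :: int assume less: "x < y"
  have x: "x mod int e < int e" "0 \<le> x mod int e" and y: "0 \<le> y mod int e" using e by auto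
  have le: "x div int e \<le> y div int e" using less e by (simp add: zdiv_mono1)
  show "position e l j x < position e l j y"
  proof (cases "x div int e = y div int e")
    case True
    then have "x mod int e < y mod int e" using less by (metis div_mult_mod_eq add_less_cancel_left)
    then show ?thesis using True by (simp add: position_def)
  next
    case False
    then have "x div int e + 1 \<le> y div int e" using le by linarith
    then have "(x div int e + 1) * int l \<le> y div int e * int l" by (rule mult_right_mono) simp
    then have "x div int e * int l + int l - j + 1 \<le> y div int e * int l + int l - j"
      using l unfolding distrib_right by linarith
    then have "(x div int e * int l + int l - j + 1) * int e \<le> (y div int e * int l + int l - j) * int e"
      by (rule mult_right_mono) simp
    then show ?thesis using x y unfolding position_def distrib_right[of _ 1] by linarith
  qed
qed

lemma inj_position: "inj (position e l j)"
  using strict_mono_position strict_mono_imp_inj_on by blast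

lemma position_range:
  "z \<in> range (position e l j) \<longleftrightarrow> (z div int e + j) mod int l = 0"
proof
  assume "z \<in> range (position e l j)"
  then obtain x where "z = position e l j x" by blast
  then have "z div int e + j = (x div int e + 1) * int l" by (simp add: position_div distrib_right)
  then show "(z div int e + j) mod int l = 0" by simp
next
  assume "(z div int e + j) mod int l = 0"
  then obtain q where q: "z div int e + j = int l * q" by blast
  define x where "x = (q - 1) * int e + z mod int e"
  have x: "x div int e = q - 1" "x mod int e = z mod int e" using e by (simp_all add: x_def div_eq_0_iff)
  have "(q - 1) * int l + int l - j = z div int e" using q by (simp add: algebra_simps)
  then have "position e l j x = z div int e * int e + z mod int e"
    unfolding position_def x by simp
  then show "z \<in> range (position e l j)" by (metis div_mult_mod_eq rangeI)
qed

lemma position_nonneg: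
  assumes "j \<in> {1..int l}"
  shows "0 \<le> position e l j x \<longleftrightarrow> 0 \<le> x"
proof -
  have "0 \<le> position e l j x \<longleftrightarrow> 0 \<le> position e l j x div int e"
    using e by (simp add: pos_imp_zdiv_nonneg_iff)
  also have "\<dots> \<longleftrightarrow> 0 \<le> x div int e"
  proof -
    have k: "l + 1 - nat j \<in> {1..l}" using assms by auto
    have "int (l + 1 - nat j) - 1 = int l - j" using assms by auto
    then have "position e l j x div int e = x div int e * int l + (int (l + 1 - nat j) - 1)"
      unfolding position_div by linarith
    then show ?thesis using runner_nonneg[OF k, of "x div int e"] by simp
  qed
  also have "\<dots> \<longleftrightarrow> 0 \<le> x" using e by (simp add: pos_imp_zdiv_nonneg_iff)
  finally show ?thesis .
qed

lemma strand_shift: "strand e l U (j + int l) = shift (int e) (strand e l U j)"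
  using position_shift[of j] by (auto simp: mem_strand) (metis diff_add_cancel)+

lemma strand_shift_mult: "strand e l U (j + n * int l) = shift (n * int e) (strand e l U j)"
proof -
  have pos: "strand e l U (j + int n * int l) = shift (int n * int e) (strand e l U j)" for n j
  proof (induction n)
    case (Suc n)
    have "j + int (Suc n) * int l = j + int n * int l + int l" by (simp add: distrib_right)
    then have "strand e l U (j + int (Suc n) * int l) = shift (int e) (strand e l U (j + int n * int l))"
      by (simp only: strand_shift)
    then show ?case using Suc by (simp add: distrib_right)
  qed simp
  show ?thesis
  proof (cases "0 \<le> n")
    case True
    then show ?thesis using pos[of j "nat n"] by simp
  next
    case False
    define j' where "j' = j + n * int l"
    have "strand e l U j = shift (- n * int e) (strand e l U j')"
      using pos[of j' "nat (- n)"] False by (simp add: j'_def)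
    then show ?thesis by (simp add: j'_def)
  qed
qed

lemma is_beta_set_strand: "is_beta_set U \<Longrightarrow> is_beta_set (strand e l U j)"
  unfolding strand_def using is_beta_set_vimage strict_mono_position by blast

lemma position_component:
  obtains j where "j \<in> {1..l}" "(z + int j) mod int l = 0"
proof -
  define j where "j = l - nat (z mod int l)"
  have "nat (z mod int l) < l" using l by (simp add: nat_less_iff)
  then have j: "j \<in> {1..l}" "int j = int l - z mod int l" using l by (auto simp: j_def)
  have "z + int j = (z div int l + 1) * int l"
    using div_mult_mod_eq[of z "int l"] j(2) unfolding distrib_right by linarith
  then have "(z + int j) mod int l = 0" by simp
  with j(1) show ?thesis by (rule that)
qed

lemma component_unique:
  assumes "j \<in> {1..l}" "k \<in> {1..l}" "(z + int j) mod int l = 0" "(z + int k) mod int l = 0"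
  shows "j = k"
proof -
  have "int l dvd (z + int j) - (z + int k)" using assms(3,4) by (intro dvd_diff) auto
  then have "int l dvd int j - int k" by simp
  moreover have "\<bar>int j - int k\<bar> < int l" using assms(1,2) by auto
  ultimately have "int j - int k = 0" using dvd_imp_le_int[of "int j - int k" "int l"] by linarith
  then show ?thesis by simp
qed

lemma position_cover:
  obtains j x where "j \<in> {1..l}" "z = position e l (int j) x"
proof -
  obtain j where j: "j \<in> {1..l}" "(z div int e + int j) mod int l = 0"
    using position_component by blast
  from j(2) have "z \<in> range (position e l (int j))" unfolding position_range .
  then show ?thesis using that j(1) by blast
qed

lemma rsum_strands:
  assumes U: "is_beta_set U"
  shows "rsum f U = (\<Sum>j=1..l. rsum (\<lambda>x. f (position e l (int j) x)) (strand e l U (int j)))"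
  unfolding strand_def
proof (rule rsum_partition[OF _ inj_position _ _ U])
  show "0 \<le> position e l (int j) x \<longleftrightarrow> 0 \<le> x" if "j \<in> {1..l}" for j x
    using position_nonneg[of "int j" x] that by simp
  show "\<exists>!j. j \<in> {1..l} \<and> z \<in> range (position e l (int j))" for z
    unfolding position_range using position_component[of "z div int e"] component_unique by metis
qed simp

lemma charge_strand_shift:
  assumes "is_beta_set U"
  shows "charge (strand e l U (j + n * int l)) = charge (strand e l U j) + n * int e"
  unfolding strand_shift_mult by (rule charge_shift[OF is_beta_set_strand[OF assms]])

lemma div_step: "(a + 1) div int l - a div int l = of_bool ((a + 1) mod int l = 0)"
proof (cases "(a + 1) mod int l = 0")
  case True
  then obtain q where "a + 1 = int l * q" by blast
  then have "a = q * int l - 1" by (simp add: mult.commute)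
  moreover have "(q * int l - 1) div int l = q - 1"
  proof -
    have "q * int l - 1 = (q - 1) * int l + (int l - 1)" unfolding left_diff_distrib by linarith
    moreover have "l \<in> {1..l}" using l by simp
    ultimately show ?thesis using runner_div_mod(1)[of l l "q - 1"] by metis
  qed
  ultimately show ?thesis using True l by simp
next
  case False
  have "(a + 1) div int l = a div int l"
  proof -
    have "a + 1 = (a + 1) div int l * int l + (a + 1) mod int l" by simp
    then have a: "a = (a + 1) div int l * int l + ((a + 1) mod int l - 1)" by linarith
    have "0 \<le> (a + 1) mod int l" "(a + 1) mod int l < int l" using l by simp_all
    then have "0 \<le> (a + 1) mod int l - 1" "(a + 1) mod int l - 1 < int l" using False by linarith+
    then have "((a + 1) div int l * int l + ((a + 1) mod int l - 1)) div int l = (a + 1) div int l"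
      using l by (simp add: div_pos_pos_trivial)
    then show ?thesis using a by metis
  qed
  then show ?thesis using False by simp
qed

lemma cut_prev: "cut_level e l i z - cut_level e l (i - 1) z = of_bool ((z div int e + i) mod int l = 0)"
  using div_step[of "z div int e + i - 1"] by (simp add: cut_level_def algebra_simps)

lemma cut_hook: "cut_level e l i (z + int e) - cut_level e l i z = of_bool ((z div int e + 1 + i) mod int l = 0)"
  using div_step[of "z div int e + i"] e by (simp add: cut_level_def algebra_simps)

lemma cut_period: "cut_level e l (i + n * int l) z = cut_level e l i z + n"
  using l by (simp add: cut_level_def flip: add.assoc)

lemma rsum_cut_period: "rsum (cut_level e l (i + n * int l)) U = rsum (cut_level e l i) U + n * charge U"
  unfolding cut_period[abs_def] using rsum_add[of "cut_level e l i" "\<lambda>_. n" U] by (simp add: rsum_const)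

text \<open>
  The cuts \<open>j - 1\<close> and \<open>j\<close> enclose strand \<open>j\<close>: beads enter it through the cut \<open>j\<close> and leave it through
  the cut \<open>j - 1\<close>.  For \<open>j\<close> outside \<open>{1..l}\<close> the map \<open>position\<close> does not respect the sign, so only the
  difference of two charges has this form.
\<close>

lemma charge_strand_diff:
  assumes U: "is_beta_set U" and C: "is_beta_set C"
  shows "charge (strand e l U j) - charge (strand e l C j)
      = (rsum (cut_level e l j) U - rsum (cut_level e l (j - 1)) U) - (rsum (cut_level e l j) C - rsum (cut_level e l (j - 1)) C)"
proof -
  let ?ind = "\<lambda>z. of_bool ((z div int e + j) mod int l = 0) :: int"
  have cut: "rsum (cut_level e l j) B - rsum (cut_level e l (j - 1)) B = rsum ?ind B" for B
    unfolding rsum_diff_fun[symmetric] cut_prev ..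
  have card: "int (card (strand e l D j)) = sum ?ind D" if "finite D" for D
  proof -
    have "card (strand e l D j) = card (position e l j ` strand e l D j)"
      by (rule card_image[OF inj_on_subset[OF inj_position], symmetric]) simp
    also have "position e l j ` strand e l D j = {z \<in> D. (z div int e + j) mod int l = 0}"
    proof (intro equalityI subsetI)
      fix z assume z: "z \<in> {z \<in> D. (z div int e + j) mod int l = 0}"
      then have "z \<in> range (position e l j)" unfolding position_range by blast
      then obtain x where "z = position e l j x" by blast
      then show "z \<in> position e l j ` strand e l D j" using z by (simp add: mem_strand)
    next
      fix z assume z: "z \<in> position e l j ` strand e l D j"
      then have "z \<in> range (position e l j)" by blast
      then show "z \<in> {z \<in> D. (z div int e + j) mod int l = 0}"
        using z position_range[of z j] by (auto simp: mem_strand)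
    qed
    finally show ?thesis using that by (simp add: of_bool_def Int_def flip: sum.inter_filter)
  qed
  have "strand e l U j - strand e l C j = strand e l (U - C) j" for U C by (auto simp: mem_strand)
  then have "charge (strand e l U j) - charge (strand e l C j) = sum ?ind (U - C) - sum ?ind (C - U)"
    unfolding charge_eq_rsum
    using rsum_diff[OF is_beta_set_strand[OF U, of j] is_beta_set_strand[OF C, of j], of "\<lambda>_. 1"]
      card beta_set_finite_diff[OF U C] beta_set_finite_diff[OF C U] by simp
  also have "\<dots> = rsum ?ind U - rsum ?ind C" using rsum_diff[OF U C, of ?ind] by simp
  finally show ?thesis by (simp add: cut)
qed

end

section \<open>Moves across a cut\<close>

text \<open>
  No bead of \<open>U\<close> can move down across the cut between the strands \<open>i\<close> and \<open>i + 1\<close>.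
\<close>

definition separated :: "nat \<Rightarrow> nat \<Rightarrow> int set \<Rightarrow> int \<Rightarrow> bool" where
  "separated e l U i \<longleftrightarrow> (\<forall>j k. j \<le> i \<and> i < k \<longrightarrow> strand e l U j \<subseteq> strand e l U k)"

lemma separatedD: "separated e l U i \<Longrightarrow> j \<le> i \<Longrightarrow> i < k \<Longrightarrow> strand e l U j \<subseteq> strand e l U k"
  by (simp add: separated_def)

context
  fixes e l :: nat
  assumes e: "0 < e" and l: "0 < l"
begin

lemma int_window:
  obtains j n where "j \<in> {1..l}" "i = int j + n * int l"
proof -
  obtain j where j: "j \<in> {1..l}" "(- i + int j) mod int l = 0"
    using position_component[OF e l, of "- i"] by blast
  then obtain q where "- i + int j = int l * q" by blast
  then have "i = int j + (- q) * int l" by (simp add: algebra_simps)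
  with j(1) show ?thesis by (rule that)
qed

text \<open>
  On a runner the level of a bead at \<open>x\<close> is \<open>(x + i) div l\<close>, which increases exactly when a step ends at a
  position congruent to \<open>-i\<close>; the telescoping sum over the nodes therefore counts a single residue.
\<close>

lemma moves_eq_sum_card:
  assumes U: "is_beta_set U"
  shows "rsum (cut_level e l i) U - rsum (cut_level e l i) (core e U)
    = (\<Sum>c=1..e. int (card {(a, b) \<in> young (beta_inv (quot e U c)).
         (int b - int a + charge (quot e U c) + i) mod int l = 0}))"
proof -
  let ?f = "\<lambda>x. (x + i) div int l"
  have "rsum (cut_level e l i) U = (\<Sum>c=1..e. rsum ?f (quot e U c))"
    using sum_rsum_quot[OF e U, of ?f] by (simp add: cut_level_def[abs_def])
  moreover have "rsum (cut_level e l i) (core e U) = (\<Sum>c=1..e. rsum ?f {..<charge (quot e U c)})"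
    using rsum_core[OF e U, of ?f] by (simp add: cut_level_def[abs_def])
  moreover have "rsum ?f (quot e U c) - rsum ?f {..<charge (quot e U c)}
      = int (card {(a, b) \<in> young (beta_inv (quot e U c)).
         (int b - int a + charge (quot e U c) + i) mod int l = 0})" for c
  proof -
    let ?B = "quot e U c" and ?Y = "young (beta_inv (quot e U c))"
    note B = is_beta_set_quot[OF e U, of c]
    have "rsum ?f ?B - rsum ?f {..<charge ?B}
        = (\<Sum>p\<in>?Y. of_bool ((int (snd p) - int (fst p) + charge ?B + i) mod int l = 0))"
      unfolding rsum_eq_sum_young[OF B, of ?f] add_diff_cancel_left'
    proof (intro sum.cong refl)
      fix p
      show "(case p of (a, b) \<Rightarrow> ?f (int b - int a + charge ?B) - ?f (int b - int a + charge ?B - 1))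
          = of_bool ((int (snd p) - int (fst p) + charge ?B + i) mod int l = 0)"
        using div_step[OF e l, of "int (snd p) - int (fst p) + charge ?B + i - 1"]
        by (simp add: case_prod_unfold algebra_simps)
    qed
    also have "\<dots> = int (card {p \<in> ?Y. (int (snd p) - int (fst p) + charge ?B + i) mod int l = 0})"
      using finite_young[OF is_partition_beta_inv[OF B]]
      by (simp add: of_bool_def Int_def flip: sum.inter_filter)
    finally show ?thesis by (simp add: case_prod_unfold)
  qed
  ultimately show ?thesis by (simp flip: sum_subtractf)
qed

lemma moves_nonneg:
  assumes "is_beta_set U"
  shows "rsum (cut_level e l i) (core e U) \<le> rsum (cut_level e l i) U"
proof -
  have "0 \<le> rsum (cut_level e l i) U - rsum (cut_level e l i) (core e U)"
    unfolding moves_eq_sum_card[OF assms] by (rule sum_nonneg) simp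
  then show ?thesis by simp
qed

text \<open>
  A node of content \<open>m \<equiv> -i\<close> on runner \<open>c\<close> is a hole below \<open>m\<close> together with a bead at or above \<open>m\<close>.  Read in
  the row of \<open>m\<close>, the bead at \<open>x\<close> lies in strand \<open>i - (x - m) \<le> i\<close> and the hole at \<open>y\<close> in strand
  \<open>i + (m - y) > i\<close>, at the same place of the two strands: the first strand is not contained in the second.
\<close>

lemma no_moves_iff:
  assumes U: "is_beta_set U"
  shows "rsum (cut_level e l i) U = rsum (cut_level e l i) (core e U)
    \<longleftrightarrow> separated e l U i"
proof -
  define A where "A c = {(a, b) \<in> young (beta_inv (quot e U c)).
         (int b - int a + charge (quot e U c) + i) mod int l = 0}" for c
  have fin: "finite (A c)" for c
  proof (rule finite_subset)
    show "A c \<subseteq> young (beta_inv (quot e U c))" by (auto simp: A_def)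
  qed (rule finite_young[OF is_partition_beta_inv[OF is_beta_set_quot[OF e U]]])
  have "rsum (cut_level e l i) U = rsum (cut_level e l i) (core e U) \<longleftrightarrow> (\<Sum>c=1..e. card (A c)) = 0"
    using moves_eq_sum_card[OF U, of i] unfolding A_def of_nat_sum[symmetric] by linarith
  also have "\<dots> \<longleftrightarrow> (\<forall>c\<in>{1..e}. A c = {})" using fin by simp
  also have "\<dots> \<longleftrightarrow> (\<forall>j k. j \<le> i \<and> i < k \<longrightarrow> strand e l U j \<subseteq> strand e l U k)"
  proof
    assume none: "\<forall>c\<in>{1..e}. A c = {}"
    show "\<forall>j k. j \<le> i \<and> i < k \<longrightarrow> strand e l U j \<subseteq> strand e l U k"
    proof (intro allI impI subsetI, rule ccontr)
      fix j k x assume jk: "j \<le> i \<and> i < k" and x: "x \<in> strand e l U j" "x \<notin> strand e l U k"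
      obtain c where c: "c \<in> {1..e}" "x mod int e = int c - 1" using runner_of e by blast
      define row where "row = x div int e * int l + int l"
      have "row - j \<in> quot e U c" "row - k \<notin> quot e U c"
        using x c(2) by (simp_all add: mem_strand mem_quot position_def row_def)
      then have "\<exists>(a, b)\<in>young (beta_inv (quot e U c)). int b - int a + charge (quot e U c) = row - i"
        unfolding card_nodes_content[OF is_beta_set_quot[OF e U]] using jk
        by (intro bexI[of _ "row - j"] exI[of _ "row - k"]) auto
      then obtain a b where ab: "(a, b) \<in> young (beta_inv (quot e U c))"
          "int b - int a + charge (quot e U c) = row - i" by blast
      then have "int b - int a + charge (quot e U c) + i = (x div int e + 1) * int l"
        by (simp add: row_def distrib_right)
      then have "(a, b) \<in> A c" using ab(1) by (simp add: A_def)
      then show False using none c(1) by blast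
    qed
  next
    assume sub: "\<forall>j k. j \<le> i \<and> i < k \<longrightarrow> strand e l U j \<subseteq> strand e l U k"
    show "\<forall>c\<in>{1..e}. A c = {}"
    proof (intro ballI, rule ccontr)
      fix c assume c: "c \<in> {1..e}" and "A c \<noteq> {}"
      then obtain a b where "(a, b) \<in> A c" by (metis ex_in_conv surj_pair)
      then have ab: "(a, b) \<in> young (beta_inv (quot e U c))"
          "(int b - int a + charge (quot e U c) + i) mod int l = 0" by (simp_all add: A_def)
      define m where "m = int b - int a + charge (quot e U c)"
      have "\<exists>(a, b)\<in>young (beta_inv (quot e U c)). int b - int a + charge (quot e U c) = m"
        using ab(1) m_def by blast
      then obtain x y where x: "x \<in> quot e U c" and y: "y \<notin> quot e U c" and xy: "y < m" "m \<le> x"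
        unfolding card_nodes_content[OF is_beta_set_quot[OF e U]] by blast
      obtain q where q: "m + i = int l * q" using ab(2) unfolding m_def by blast
      define p where "p = (q - 1) * int e + (int c - 1)"
      have p: "p div int e = q - 1" "p mod int e = int c - 1"
        unfolding p_def using runner_div_mod[OF c] by auto
      have rows: "(q - 1) * int l + int l - (i - (x - m)) = x" "(q - 1) * int l + int l - (i + (m - y)) = y"
        using q by (simp_all add: algebra_simps)
      have "p \<in> strand e l U (i - (x - m))" "p \<notin> strand e l U (i + (m - y))"
        using x y unfolding mem_strand mem_quot position_def p rows by simp_all
      moreover have "i - (x - m) \<le> i" "i < i + (m - y)" using xy by auto
      ultimately show False using sub by blast
    qed
  qed
  finally show ?thesis unfolding separated_def .
qed

text \<open>
  This is the argument by which dominant weights below the highest weight occur in an integrable module.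
  Let \<open>g\<^sub>i \<ge> 0\<close> be the number of moves across the cut \<open>i\<close> that \<open>V\<close> still lacks.  If some cut with \<open>g\<^sub>i > 0\<close>
  admits a move, make it.  Otherwise \<open>X\<^bsub>i+1\<^esub> \<subseteq> X\<^sub>i\<close> in \<open>V\<close> for every cut with \<open>g\<^sub>i > 0\<close>, so there the charges
  of \<open>V\<close> do not increase, while those of the target do not decrease.  This makes \<open>g\<close> convex wherever it is positive;
  being periodic, a nonzero \<open>g\<close> is a positive constant, and then the charges of \<open>V\<close> never increase,
  which contradicts \<open>X\<^bsub>j+l\<^esub> = X\<^sub>j + e\<close>.
\<close>

lemma lower_moves:
  assumes U: "is_beta_set U"
    and dom: "\<And>j. charge (strand e l U j) \<le> charge (strand e l U (j + 1))"
    and V: "is_beta_set V"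
    and quot: "\<And>c. c \<in> {1..e} \<Longrightarrow> charge (quot e V c) = charge (quot e U c)"
    and less: "\<And>i. rsum (cut_level e l i) V < rsum (cut_level e l i) U"
  shows "\<exists>V'. is_beta_set V' \<and> (\<forall>c\<in>{1..e}. charge (quot e V' c) = charge (quot e U c))
      \<and> (\<forall>i. rsum (cut_level e l i) V' = rsum (cut_level e l i) U - 1)"
  using V quot less
proof (induction "nat (\<Sum>i=1..l. rsum (cut_level e l (int i)) U - 1 - rsum (cut_level e l (int i)) V)"
    arbitrary: V rule: less_induct)
  case less
  note V = less.prems(1) and quotV = less.prems(2) and lessV = less.prems(3)
  define g where "g V i = rsum (cut_level e l i) U - 1 - rsum (cut_level e l i) V" for V i
  have chV: "charge V = charge U"
    using sum_charge_quot[OF e V] sum_charge_quot[OF e U] quotV by simp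
  have g0: "0 \<le> g V i" for i using lessV[of i] by (simp add: g_def)
  have per: "g V (i + n * int l) = g V i" for i n
    by (simp add: g_def rsum_cut_period[OF e l] chV)
  have gmod: "g V k = g V i" if "(k - i) mod int l = 0" for k i
  proof -
    from that have "int l dvd k - i" by (simp add: dvd_eq_mod_eq_0)
    then obtain q where "k - i = int l * q" by blast
    then have "k = i + q * int l" by (simp add: algebra_simps)
    then show ?thesis using per by simp
  qed
  show ?case
  proof (cases "\<exists>i. 0 < g V i \<and> \<not> strand e l V (i + 1) \<subseteq> strand e l V i")
    case True
    then obtain i x where i: "0 < g V i" and x: "x \<in> strand e l V (i + 1)" "x \<notin> strand e l V i" by blast
    define z where "z = position e l (i + 1) x"
    have zV: "z \<in> V" "z + int e \<notin> V"
      using x position_next[OF e l, of "i + 1" x] by (simp_all add: mem_strand z_def)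
    define V' where "V' = insert (z + int e) (V - {z})"
    have rsumV': "rsum f V' = rsum f V + f (z + int e) - f z" for f
      unfolding V'_def by (rule rsum_move_bead(1)[OF V zV])
    have V': "is_beta_set V'" unfolding V'_def by (rule rsum_move_bead(2)[OF V zV])
    have row: "z div int e + 1 + k = (x div int e + 1) * int l + (k - i)" for k
      by (simp add: z_def position_div[OF e l] algebra_simps)
    have "(z div int e + 1 + k) mod int l = (k - i) mod int l" for k
      unfolding row by (rule mod_mult_self3)
    then have gV': "g V' k = g V k - of_bool ((k - i) mod int l = 0)" for k
      using cut_hook[OF e l, of k z] rsumV'[of "cut_level e l k"] by (simp add: g_def)
    have ge: "0 \<le> g V' k" for k using gV'[of k] g0[of k] gmod[of k i] i by auto
    obtain j n where j: "j \<in> {1..l}" "i = int j + n * int l" by (rule int_window)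
    have "(\<Sum>k=1..l. g V' (int k)) < (\<Sum>k=1..l. g V (int k))"
    proof (rule sum_strict_mono_ex1)
      have "(int j - i) mod int l = 0" by (simp add: j(2))
      then show "\<exists>k\<in>{1..l}. g V' (int k) < g V (int k)" using gV'[of "int j"] j(1) by force
    qed (simp_all add: gV')
    moreover have "0 \<le> (\<Sum>k=1..l. g V' (int k))" by (rule sum_nonneg) (rule ge)
    ultimately have "nat (\<Sum>k=1..l. g V' (int k)) < nat (\<Sum>k=1..l. g V (int k))" by linarith
    moreover have "charge (quot e V' c) = charge (quot e U c)" if c: "c \<in> {1..e}" for c
    proof -
      have "charge (quot e V' c) = charge (quot e V c)"
        unfolding charge_quot_eq_rsum[OF c V'] charge_quot_eq_rsum[OF c V] rsumV' by simp
      then show ?thesis using quotV[OF c] by simp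
    qed
    moreover have "rsum (cut_level e l k) V' < rsum (cut_level e l k) U" for k using ge[of k] by (simp add: g_def)
    ultimately show ?thesis using less.hyps[OF _ V'] unfolding g_def by blast
  next
    case False
    have zero: "g V i = 0" for i
    proof (rule ccontr)
      assume "g V i \<noteq> 0"
      define G where "G = Max ((\<lambda>k. g V (int k)) ` {1..l})"
      have "G \<in> (\<lambda>k. g V (int k)) ` {1..l}" unfolding G_def using l by (intro Max_in) auto
      then obtain k0 where k0: "g V (int k0) = G" by auto
      have G: "g V k \<le> G" for k
      proof -
        obtain j n where j: "j \<in> {1..l}" "k = int j + n * int l" by (rule int_window)
        then show ?thesis using per[of "int j" n] unfolding G_def by (auto intro: Max_ge)
      qed
      have G0: "0 < G" using G[of i] g0[of i] \<open>g V i \<noteq> 0\<close> by linarith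
      define c where "c j = charge (strand e l V j)" for j
      have c: "c j = charge (strand e l U j) - g V j + g V (j - 1)" for j
        using charge_strand_diff[OF e l U V, of j] by (simp add: c_def g_def)
      \<comment> \<open>maximum principle: at a maximum of \<open>g\<close> convexity forces both neighbours to be maximal\<close>
      have step: "c (k + 1) \<le> c k \<and> g V (k + 1) = G" if "g V k = G" for k
      proof -
        have "strand e l V (k + 1) \<subseteq> strand e l V k" using False that G0 by auto
        then have le: "c (k + 1) \<le> c k"
          unfolding c_def by (intro charge_mono is_beta_set_strand[OF e l V])
        then have "2 * g V k \<le> g V (k + 1) + g V (k - 1)"
          using c[of k] c[of "k + 1"] dom[of k] by simp
        then show ?thesis using le that G[of "k + 1"] G[of "k - 1"] by linarith
      qed
      have run: "g V (int k0 + int n) = G \<and> c (int k0 + int n) \<le> c (int k0)" for n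
      proof (induction n)
        case (Suc n)
        then show ?case using step[of "int k0 + int n"] by (simp add: algebra_simps)
      qed (simp add: k0)
      have "c (int k0 + int l) = c (int k0) + int e"
        using charge_strand_shift[OF e l V, of "int k0" 1] by (simp add: c_def)
      then show False using run[of l] e by simp
    qed
    have "rsum (cut_level e l i) V = rsum (cut_level e l i) U - 1" for i using zero[of i] by (simp add: g_def)
    then show ?thesis using V quotV by blast
  qed
qed

text \<open>
  Moving a bead up by \<open>e * l\<close> is one step inside its strand and crosses every cut once, so it compensates the
  moves taken away by \<open>lower_moves\<close>.  Applied to the largest bead, it leaves a hole below a bead of the same
  runner of that strand.
\<close>

lemma ex_noncore:
  assumes U: "is_beta_set U"
    and dom: "\<And>j. charge (strand e l U j) \<le> charge (strand e l U (j + 1))"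
    and pos: "\<And>i. i \<in> {1..l} \<Longrightarrow> rsum (cut_level e l (int i)) U \<noteq> rsum (cut_level e l (int i)) (core e U)"
  shows "\<exists>V. is_beta_set V \<and> (\<forall>c\<in>{1..e}. charge (quot e V c) = charge (quot e U c))
      \<and> (\<forall>i. rsum (cut_level e l i) V = rsum (cut_level e l i) U)
      \<and> (\<exists>j\<in>{1..l}. \<exists>x. x + int e \<in> strand e l V (int j) \<and> x \<notin> strand e l V (int j))"
proof -
  have "rsum (cut_level e l i) (core e U) < rsum (cut_level e l i) U" for i
  proof -
    obtain j n where j: "j \<in> {1..l}" "i = int j + n * int l" by (rule int_window)
    then show ?thesis
      using pos[OF j(1)] moves_nonneg[OF U, of "int j"] charge_core[OF e U]
      by (simp add: rsum_cut_period[OF e l])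
  qed
  then obtain V where V: "is_beta_set V" and quotV: "\<forall>c\<in>{1..e}. charge (quot e V c) = charge (quot e U c)"
      and cutV: "\<forall>i. rsum (cut_level e l i) V = rsum (cut_level e l i) U - 1"
    using lower_moves[OF U dom is_beta_set_core[OF e U]] quot_core[OF e U] by auto
  obtain z where z: "z \<in> V" "\<forall>x\<in>V. x \<le> z" using V unfolding is_beta_set_def by blast
  have "z < z + int e * int l" using e l by simp
  then have zV: "z + int e * int l \<notin> V" using z(2) by (meson linorder_not_le)
  define W where "W = insert (z + int e * int l) (V - {z})"
  have W: "is_beta_set W" and rsumW: "rsum f W = rsum f V + f (z + int e * int l) - f z" for f
    unfolding W_def by (rule rsum_move_bead[OF V z(1) zV])+
  have "charge (quot e W c) = charge (quot e U c)" if c: "c \<in> {1..e}" for c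
  proof -
    have "charge (quot e W c) = charge (quot e V c)"
      unfolding charge_quot_eq_rsum[OF c W] charge_quot_eq_rsum[OF c V] rsumW by simp
    then show ?thesis using quotV c by simp
  qed
  moreover have "rsum (cut_level e l i) W = rsum (cut_level e l i) U" for i
  proof -
    have row: "(z + int e * int l) div int e + i = z div int e + i + 1 * int l" using e by simp
    have "cut_level e l i (z + int e * int l) = cut_level e l i z + 1"
      unfolding cut_level_def row using l by (subst div_mult_self1) auto
    then show ?thesis using cutV rsumW[of "cut_level e l i"] by simp
  qed
  moreover have "\<exists>j\<in>{1..l}. \<exists>x. x + int e \<in> strand e l W (int j) \<and> x \<notin> strand e l W (int j)"
  proof -
    obtain j x where j: "j \<in> {1..l}" and x: "z = position e l (int j) x"
      using position_cover[OF e l] by blast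
    have "x + int e \<in> strand e l W (int j)"
      by (simp add: mem_strand position_row_shift[OF e l] W_def x)
    moreover have "x \<notin> strand e l W (int j)" using e l by (simp add: mem_strand W_def x)
    ultimately show ?thesis using j by blast
  qed
  ultimately show ?thesis using W by blast
qed

end

section \<open>Multipartitions, moving vectors and blocks\<close>

text \<open>
  The charges of the runners of \<open>U\<close>, computed from the components: the Uglov map preserves residues
  modulo \<open>e\<close>.
\<close>

definition quot_charge :: "nat \<Rightarrow> nat \<Rightarrow> (nat \<Rightarrow> int set) \<Rightarrow> nat \<Rightarrow> int" where
  "quot_charge e l X c = (\<Sum>j=1..l. charge (quot e (X j) c))"

text \<open>
  Once the charges of the components and of the runners are given, this number determines the weight and
  each entry of the moving vector.
\<close>

definition row_sum :: "nat \<Rightarrow> nat \<Rightarrow> (nat \<Rightarrow> int set) \<Rightarrow> int" where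
  "row_sum e l X = (\<Sum>j=1..l. rsum (\<lambda>x. x div int e) (X j))"

lemma is_beta_set_mbeta: "is_multipartition l lam \<Longrightarrow> j \<in> {1..l} \<Longrightarrow> is_beta_set (mbeta t lam j)"
  by (simp add: mbeta_def is_multipartition_def is_beta_set_beta)

lemma charge_mbeta: "is_multipartition l lam \<Longrightarrow> j \<in> {1..l} \<Longrightarrow> charge (mbeta t lam j) = t j"
  by (simp add: mbeta_def is_multipartition_def charge_beta)

context
  fixes e l :: nat
  assumes e: "0 < e" and l: "0 < l"
begin

lemma strand_Uglov:
  assumes j: "j \<in> {1..l}"
  shows "strand e l (Uglov l e X) (int j) = X j"
proof (intro equalityI subsetI)
  fix x assume "x \<in> strand e l (Uglov l e X) (int j)"
  then obtain k y where k: "k \<in> {1..l}" "y \<in> X k" and eq: "position e l (int j) x = position e l (int k) y"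
    unfolding mem_strand Uglov_def upsilon_eq_position by blast
  have "position e l (int j) x \<in> range (position e l (int j))"
       "position e l (int j) x \<in> range (position e l (int k))"
    unfolding eq by (simp_all only: rangeI) (simp only: rangeI flip: eq)
  then have "j = k" unfolding position_range[OF e l] by (rule component_unique[OF e l j k(1)])
  then show "x \<in> X j" using k(2) eq inj_position[OF e l] by (metis injD)
next
  fix x assume "x \<in> X j"
  then show "x \<in> strand e l (Uglov l e X) (int j)"
    using j unfolding mem_strand Uglov_def upsilon_eq_position by blast
qed

lemma is_beta_set_Uglov:
  assumes X: "\<And>j. j \<in> {1..l} \<Longrightarrow> is_beta_set (X j)"
  shows "is_beta_set (Uglov l e X)"
proof -
  obtain m M where m: "\<And>j. j \<in> {1..l} \<Longrightarrow> {..<m j} \<subseteq> X j" and M: "\<And>j. j \<in> {1..l} \<Longrightarrow> X j \<subseteq> {..<M j}"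
    using X unfolding is_beta_set_iff by metis
  define p where "p j x = position e l (int j) x" for j x
  have less: "p j x < p j y \<longleftrightarrow> x < y" for j x y
    unfolding p_def using strict_mono_position[OF e l] by (rule strict_mono_less)
  have fin: "finite (f ` {1..l})" for f :: "nat \<Rightarrow> int" by simp
  have "{..<Min ((\<lambda>j. p j (m j)) ` {1..l})} \<subseteq> Uglov l e X"
  proof
    fix z assume z: "z \<in> {..<Min ((\<lambda>j. p j (m j)) ` {1..l})}"
    obtain j x where j: "j \<in> {1..l}" and x: "z = p j x"
      unfolding p_def using position_cover[OF e l] by blast
    have "Min ((\<lambda>j. p j (m j)) ` {1..l}) \<le> p j (m j)" using j by (intro Min_le) auto
    then have "p j x < p j (m j)" using z x by simp
    then have "x \<in> X j" using m[OF j] less by auto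
    then show "z \<in> Uglov l e X" using j unfolding Uglov_def upsilon_eq_position x p_def by blast
  qed
  moreover have "Uglov l e X \<subseteq> {..<Max ((\<lambda>j. p j (M j)) ` {1..l})}"
  proof
    fix z assume "z \<in> Uglov l e X"
    then obtain j x where j: "j \<in> {1..l}" and x: "x \<in> X j" "z = p j x"
      unfolding Uglov_def upsilon_eq_position p_def by blast
    have "p j (M j) \<le> Max ((\<lambda>j. p j (M j)) ` {1..l})" using j by (intro Max_ge) auto
    moreover have "p j x < p j (M j)" using M[OF j] x(1) less by auto
    ultimately show "z \<in> {..<Max ((\<lambda>j. p j (M j)) ` {1..l})}" using x(2) by simp
  qed
  ultimately show ?thesis unfolding is_beta_set_iff by blast
qed

lemma
  assumes U: "is_beta_set U" and X: "\<And>j. j \<in> {1..l} \<Longrightarrow> strand e l U (int j) = X j"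
  shows charge_eq_sum_strands: "charge U = (\<Sum>j=1..l. charge (X j))"
    and charge_quot_eq_quot_charge: "\<And>c. c \<in> {1..e} \<Longrightarrow> charge (quot e U c) = quot_charge e l X c"
    and rsum_rows: "rsum (\<lambda>z. z div int e) U
      = int l * row_sum e l X + (\<Sum>j=1..l. (int l - int j) * charge (X j))"
    and rsum_cut: "rsum (cut_level e l i) U
      = row_sum e l X + (\<Sum>j=1..l. ((int l - int j + i) div int l) * charge (X j))"
proof -
  have strands: "rsum f U = (\<Sum>j=1..l. rsum (\<lambda>x. f (position e l (int j) x)) (X j))" for f
    unfolding rsum_strands[OF e l U] by (intro sum.cong refl) (simp add: X)
  have XB: "is_beta_set (X j)" if "j \<in> {1..l}" for j
    using is_beta_set_strand[OF e l U, of "int j"] X[OF that] by simp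
  show "charge U = (\<Sum>j=1..l. charge (X j))"
    unfolding charge_eq_rsum strands ..
  show "charge (quot e U c) = quot_charge e l X c" if c: "c \<in> {1..e}" for c
    unfolding charge_quot_eq_rsum[OF c U] strands position_mod[OF e l] quot_charge_def
    by (intro sum.cong refl) (simp add: charge_quot_eq_rsum[OF c XB])
  have "rsum (\<lambda>x. position e l (int j) x div int e) (X j)
      = int l * rsum (\<lambda>x. x div int e) (X j) + (int l - int j) * charge (X j)" for j
  proof -
    have "position e l (int j) x div int e = int l * (x div int e) + (int l - int j)" for x
      by (simp add: position_div[OF e l])
    then show ?thesis by (simp only: rsum_add rsum_cmult rsum_const)
  qed
  then show "rsum (\<lambda>z. z div int e) U
      = int l * row_sum e l X + (\<Sum>j=1..l. (int l - int j) * charge (X j))"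
    unfolding strands row_sum_def by (simp only: sum.distrib sum_distrib_left)
  have "rsum (\<lambda>x. cut_level e l i (position e l (int j) x)) (X j)
      = rsum (\<lambda>x. x div int e) (X j) + ((int l - int j + i) div int l) * charge (X j)" for j
  proof -
    have "cut_level e l i (position e l (int j) x) = x div int e + (int l - int j + i) div int l" for x
    proof -
      have "position e l (int j) x div int e + i = (int l - int j + i) + x div int e * int l"
        by (simp add: position_div[OF e l])
      then show ?thesis using l unfolding cut_level_def by (simp only: div_mult_self1)
    qed
    then show ?thesis by (simp only: rsum_add rsum_const)
  qed
  then show "rsum (cut_level e l i) U
      = row_sum e l X + (\<Sum>j=1..l. ((int l - int j + i) div int l) * charge (X j))"
    unfolding strands row_sum_def by (simp only: sum.distrib)
qed

text \<open>
  Entry \<open>i\<close> counts the nodes of residue \<open>l - i\<close>, that is, of content congruent to \<open>-i\<close>.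
\<close>

lemma mv_eq:
  fixes t :: "nat \<Rightarrow> int"
  assumes lam: "is_multipartition l lam" and i: "i \<in> {1..l}"
  defines "U \<equiv> Uglov l e (mbeta t lam)"
  shows "int (mv l e (lam, t) i) = rsum (cut_level e l (int i)) U - rsum (cut_level e l (int i)) (core e U)"
proof -
  have U: "is_beta_set U" unfolding U_def by (rule is_beta_set_Uglov) (rule is_beta_set_mbeta[OF lam])
  define A where "A c = {(a, b) \<in> young (beta_inv (quot e U c)).
         (int b - int a + charge (quot e U c) + int i) mod int l = 0}" for c
  have fin: "finite (A c)" for c
  proof (rule finite_subset)
    show "A c \<subseteq> young (beta_inv (quot e U c))" by (auto simp: A_def)
  qed (rule finite_young[OF is_partition_beta_inv[OF is_beta_set_quot[OF e U]]])
  define N where "N = {x \<in> nodes e (\<lambda>c. beta_inv (quot e U c)).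
        residue l (\<lambda>c. charge (quot e U c)) x = int l - int i}"
  have res: "m mod int l = int l - int i \<longleftrightarrow> (m + int i) mod int l = 0" for m
  proof
    assume "m mod int l = int l - int i"
    then have "m + int i = (m div int l + 1) * int l"
      using div_mult_mod_eq[of m "int l"] unfolding distrib_right by linarith
    then show "(m + int i) mod int l = 0" by simp
  next
    assume "(m + int i) mod int l = 0"
    then obtain q where q: "m + int i = int l * q" by blast
    have "m = (q - 1) * int l + (int (l + 1 - i) - 1)" using q i by (simp add: algebra_simps of_nat_diff)
    moreover have "l + 1 - i \<in> {1..l}" using i by auto
    ultimately have "m mod int l = int (l + 1 - i) - 1" using runner_div_mod(2)[of "l + 1 - i" l "q - 1"] by metis
    then show "m mod int l = int l - int i" using i by auto
  qed
  have "N = (\<lambda>(c, a, b). (a, b, c)) ` (SIGMA c:{1..e}. A c)"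
  proof (intro equalityI subsetI)
    fix x assume x: "x \<in> N"
    obtain a b c where abc: "x = (a, b, c)" by (metis surj_pair)
    then have "c \<in> {1..e}" "(a, b) \<in> A c"
      using x by (simp_all add: N_def nodes_def A_def young_def res del: mod_0_imp_dvd)
    then show "x \<in> (\<lambda>(c, a, b). (a, b, c)) ` (SIGMA c:{1..e}. A c)"
      using abc by (intro image_eqI[of _ _ "(c, a, b)"]) auto
  next
    fix x assume "x \<in> (\<lambda>(c, a, b). (a, b, c)) ` (SIGMA c:{1..e}. A c)"
    then obtain a b c where abc: "x = (a, b, c)" "c \<in> {1..e}" "(a, b) \<in> A c" by auto
    then show "x \<in> N" by (simp add: N_def nodes_def A_def young_def res)
  qed
  moreover have "inj_on (\<lambda>(c, a, b). (a, b, c)) (SIGMA c:{1..e}. A c)" by (rule inj_onI) auto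
  ultimately have "card N = card (SIGMA c:{1..e}. A c)" by (simp only: card_image)
  also have "\<dots> = (\<Sum>c=1..e. card (A c))" using fin by simp
  finally have "int (card N) = rsum (cut_level e l (int i)) U - rsum (cut_level e l (int i)) (core e U)"
    unfolding moves_eq_sum_card[OF e l U] A_def by simp
  then show ?thesis by (simp add: mv_def iota_def Let_def N_def U_def)
qed

lemma core_wt_eq_iff:
  assumes lam: "is_multipartition l lam" and mu: "is_multipartition l mu"
  shows "beta_inv (mcore l e mu t) = beta_inv (mcore l e lam t) \<and> mwt l e mu t = mwt l e lam t
    \<longleftrightarrow> (\<forall>c\<in>{1..e}. quot_charge e l (mbeta t mu) c = quot_charge e l (mbeta t lam) c)
      \<and> row_sum e l (mbeta t mu) = row_sum e l (mbeta t lam)"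
proof -
  define U where "U lam = Uglov l e (mbeta t lam)" for lam
  have U: "is_beta_set (U lam)" if "is_multipartition l lam" for lam
    unfolding U_def by (rule is_beta_set_Uglov) (rule is_beta_set_mbeta[OF that])
  have strands: "strand e l (U lam) (int j) = mbeta t lam j" if "j \<in> {1..l}" for j lam
    unfolding U_def using that by (rule strand_Uglov)
  have q: "charge (quot e (U lam) c) = quot_charge e l (mbeta t lam) c"
    if "is_multipartition l lam" "c \<in> {1..e}" for lam c
    by (rule charge_quot_eq_quot_charge[OF U[OF that(1)] strands that(2)])
  have ch: "charge (U lam) = (\<Sum>j=1..l. t j)" if "is_multipartition l lam" for lam
    using charge_eq_sum_strands[OF U[OF that] strands] charge_mbeta[OF that] by simp
  have r: "rsum (\<lambda>z. z div int e) (U lam)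
      = int l * row_sum e l (mbeta t lam) + (\<Sum>j=1..l. (int l - int j) * t j)"
    if "is_multipartition l lam" for lam
    using rsum_rows[OF U[OF that] strands] charge_mbeta[OF that] by simp
  have "beta_inv (mcore l e mu t) = beta_inv (mcore l e lam t)
      \<longleftrightarrow> (\<forall>c\<in>{1..e}. quot_charge e l (mbeta t mu) c = quot_charge e l (mbeta t lam) c)"
    using beta_inv_core_eq_iff[OF e U[OF mu] U[OF lam]] ch[OF lam] ch[OF mu]
    by (simp add: mcore_def q[OF lam] q[OF mu] flip: U_def)
  moreover have "mwt l e mu t = mwt l e lam t \<longleftrightarrow> row_sum e l (mbeta t mu) = row_sum e l (mbeta t lam)"
    if "\<forall>c\<in>{1..e}. quot_charge e l (mbeta t mu) c = quot_charge e l (mbeta t lam) c"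
  proof -
    have "core e (U mu) = core e (U lam)"
      using core_eqI[OF e U[OF mu] U[OF lam]] that q[OF lam] q[OF mu] by simp
    then have "rsum (\<lambda>z. z div int e) (core e (U mu)) = rsum (\<lambda>z. z div int e) (core e (U lam))"
      by (rule arg_cong)
    then have "mwt l e mu t = mwt l e lam t
        \<longleftrightarrow> rsum (\<lambda>z. z div int e) (U mu) = rsum (\<lambda>z. z div int e) (U lam)"
      using wt_eq_rsum[OF e U[OF mu]] wt_eq_rsum[OF e U[OF lam]]
      unfolding mwt_def U_def[symmetric] by (intro iffI) linarith+
    then show ?thesis using r[OF lam] r[OF mu] l by simp
  qed
  ultimately show ?thesis by blast
qed

lemma quot_shift: "quot e (shift (int e * v) B) c = shift v (quot e B c)"
  by (auto simp: mem_quot algebra_simps)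

lemma rsum_row_shift:
  assumes "is_beta_set B"
  shows "rsum (\<lambda>x. x div int e) (shift (int e * v) B)
    = rsum (\<lambda>x. x div int e) B + v * charge B + rsum (\<lambda>x. x div int e) {..<int e * v}"
proof -
  have "(x + int e * v) div int e = x div int e + v" for x using e by simp
  then show ?thesis unfolding rsum_shift[OF assms] by (simp only: rsum_add rsum_const)
qed

lemma
  fixes v :: "nat \<Rightarrow> int"
  assumes s: "s permutes {1..l}" and X: "\<And>j. j \<in> {1..l} \<Longrightarrow> is_beta_set (X j)"
  defines "Y \<equiv> \<lambda>j. shift (int e * v j) (X (s j))"
  shows quot_charge_act: "quot_charge e l Y c = quot_charge e l X c + (\<Sum>j=1..l. v j)"
    and row_sum_act: "row_sum e l Y = row_sum e l X + (\<Sum>j=1..l. v j * charge (X (s j)))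
      + (\<Sum>j=1..l. rsum (\<lambda>x. x div int e) {..<int e * v j})"
proof -
  have XB: "is_beta_set (X (s j))" if "j \<in> {1..l}" for j
    using X that permutes_in_image[OF s] by blast
  have perm: "(\<Sum>j=1..l. f (s j)) = (\<Sum>j=1..l. f j)" for f :: "nat \<Rightarrow> int"
    using sum.permute[OF s, of f] by (simp add: o_def)
  have "charge (quot e (Y j) c) = charge (quot e (X (s j)) c) + v j" if "j \<in> {1..l}" for j
    unfolding Y_def quot_shift by (rule charge_shift[OF is_beta_set_quot[OF e XB[OF that]]])
  then show "quot_charge e l Y c = quot_charge e l X c + (\<Sum>j=1..l. v j)"
    using perm[of "\<lambda>j. charge (quot e (X j) c)"] by (simp add: quot_charge_def sum.distrib)
  have "rsum (\<lambda>x. x div int e) (Y j) = rsum (\<lambda>x. x div int e) (X (s j)) + v j * charge (X (s j))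
      + rsum (\<lambda>x. x div int e) {..<int e * v j}" if "j \<in> {1..l}" for j
    unfolding Y_def by (rule rsum_row_shift[OF XB[OF that]])
  then show "row_sum e l Y = row_sum e l X + (\<Sum>j=1..l. v j * charge (X (s j)))
      + (\<Sum>j=1..l. rsum (\<lambda>x. x div int e) {..<int e * v j})"
    using perm[of "\<lambda>j. rsum (\<lambda>x. x div int e) (X j)"] by (simp add: row_sum_def sum.distrib)
qed

lemma mbeta_act: "mbeta (\<lambda>j. r (s j) + int e * v j) (\<lambda>j. lam (s j)) = (\<lambda>j. shift (int e * v j) (mbeta r lam (s j)))"
  by (simp add: mbeta_def shift_beta)

lemma is_multipartition_act:
  assumes "is_multipartition l lam" "s permutes {1..l}"
  shows "is_multipartition l (\<lambda>j. lam (s j))"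
  using assms permutes_in_image[OF assms(2)] unfolding is_multipartition_def by blast

text \<open>
  Acting by \<open>w\<close> permutes the components and translates them by multiples of \<open>e\<close>.  The translations change both
  invariants by amounts that depend only on \<open>w\<close> and the charges, hence by the same amount for \<open>lam\<close> and for \<open>mu\<close>.
\<close>

lemma core_wt_act_eq_iff:
  assumes lam: "is_multipartition l lam" and mu: "is_multipartition l mu" and w: "w \<in> W_hat l"
  shows "beta_inv (case_prod (mcore l e) (act e (mu, r) w)) = beta_inv (case_prod (mcore l e) (act e (lam, r) w))
      \<and> case_prod (mwt l e) (act e (mu, r) w) = case_prod (mwt l e) (act e (lam, r) w)
    \<longleftrightarrow> (\<forall>c\<in>{1..e}. quot_charge e l (mbeta r mu) c = quot_charge e l (mbeta r lam) c)
      \<and> row_sum e l (mbeta r mu) = row_sum e l (mbeta r lam)"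
proof -
  obtain s v where sv: "w = (s, v)" "s permutes {1..l}" using w by (auto simp: W_hat_def)
  have ch: "(\<Sum>j=1..l. v j * charge (mbeta r mu (s j))) = (\<Sum>j=1..l. v j * charge (mbeta r lam (s j)))"
    using charge_mbeta[OF lam] charge_mbeta[OF mu] permutes_in_image[OF sv(2)] by (intro sum.cong refl) simp
  note lamB = is_beta_set_mbeta[OF lam, where t = r] and muB = is_beta_set_mbeta[OF mu, where t = r]
  show ?thesis
    using core_wt_eq_iff[OF is_multipartition_act[OF lam sv(2)] is_multipartition_act[OF mu sv(2)],
        of "\<lambda>j. r (s j) + int e * v j"] ch
      quot_charge_act[OF sv(2), where X = "mbeta r lam" and v = v, OF lamB]
      quot_charge_act[OF sv(2), where X = "mbeta r mu" and v = v, OF muB]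
      row_sum_act[OF sv(2), where X = "mbeta r lam" and v = v, OF lamB]
      row_sum_act[OF sv(2), where X = "mbeta r mu" and v = v, OF muB]
    unfolding mbeta_act sv(1) act.simps case_prod_conv by simp
qed

end

section \<open>The weight graph\<close>

lemma (in wf_digraph) not_connected_iff_cut:
  assumes ne: "verts G \<noteq> {}"
  shows "\<not> connected G \<longleftrightarrow> (\<exists>C. C \<subseteq> verts G \<and> C \<noteq> {} \<and> C \<noteq> verts G \<and>
           (\<forall>a\<in>arcs G. tail G a \<in> C \<longleftrightarrow> head G a \<in> C))"
proof
  let ?S = "with_proj (mk_symmetric G)"
  interpret S: pair_wf_digraph "mk_symmetric G" by (rule wellformed_mk_symmetric)
  have adj: "tail G a \<rightarrow>\<^bsub>?S\<^esub> head G a" "head G a \<rightarrow>\<^bsub>?S\<^esub> tail G a" if "a \<in> arcs G" for a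
    using that by (auto simp: parcs_mk_symmetric)
  {
    assume "\<not> connected G"
    then obtain u v where uv: "u \<in> verts G" "v \<in> verts G" "\<not> u \<rightarrow>\<^sup>*\<^bsub>?S\<^esub> v"
      using ne by (auto simp: connected_def strongly_connected_def)
    let ?C = "{x \<in> verts G. u \<rightarrow>\<^sup>*\<^bsub>?S\<^esub> x}"
    have "tail G a \<in> ?C \<longleftrightarrow> head G a \<in> ?C" if "a \<in> arcs G" for a
      using adj[OF that] that S.reachable_adj_trans by auto
    moreover have "u \<in> ?C" using uv(1) by simp
    ultimately show "\<exists>C. C \<subseteq> verts G \<and> C \<noteq> {} \<and> C \<noteq> verts G \<and>
           (\<forall>a\<in>arcs G. tail G a \<in> C \<longleftrightarrow> head G a \<in> C)"
      using uv by (intro exI[of _ ?C]) blast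
  next
    assume "\<exists>C. C \<subseteq> verts G \<and> C \<noteq> {} \<and> C \<noteq> verts G \<and>
           (\<forall>a\<in>arcs G. tail G a \<in> C \<longleftrightarrow> head G a \<in> C)"
    then obtain C u v where C: "\<forall>a\<in>arcs G. tail G a \<in> C \<longleftrightarrow> head G a \<in> C"
      and uv: "u \<in> C" "u \<in> verts G" "v \<in> verts G" "v \<notin> C" by blast
    have "x \<in> C" if "u \<rightarrow>\<^sup>*\<^bsub>?S\<^esub> x" for x
      using that
    proof (induction rule: S.reachable_induct)
      case (step x y)
      then have "(x, y) \<in> parcs (mk_symmetric G)" by simp
      then show ?case using step.IH C unfolding parcs_mk_symmetric by auto
    qed (rule uv(1))
    then have "\<not> u \<rightarrow>\<^sup>*\<^bsub>?S\<^esub> v" using uv(4) by blast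
    then show "\<not> connected G" using uv by (auto simp: connected_def strongly_connected_def)
  }
qed

text \<open>
  The condition for two vertices not to be joined, in a form that is symmetric and unaffected by translations by
  multiples of \<open>e\<close>; it therefore needs no representative in the alcove.
\<close>

definition comparable :: "nat \<Rightarrow> int set \<Rightarrow> int set \<Rightarrow> bool" where
  "comparable e A B \<longleftrightarrow> (\<forall>n. shift (int e * n) A \<subseteq> B \<or> B \<subseteq> shift (int e * n) A)"

lemma shift_mono: "A \<subseteq> B \<Longrightarrow> shift n A \<subseteq> shift n B"
  by auto

lemma shift_subset_shift: "shift m A \<subseteq> shift n B \<longleftrightarrow> shift (m - n) A \<subseteq> B"
proof
  assume "shift m A \<subseteq> shift n B"
  then have "shift (- n) (shift m A) \<subseteq> shift (- n) (shift n B)" by (rule shift_mono)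
  then show "shift (m - n) A \<subseteq> B" by simp
next
  assume "shift (m - n) A \<subseteq> B"
  then have "shift n (shift (m - n) A) \<subseteq> shift n B" by (rule shift_mono)
  then show "shift m A \<subseteq> shift n B" by simp
qed

lemma subset_shift: "A \<subseteq> shift n B \<longleftrightarrow> shift (- n) A \<subseteq> B"
  using shift_subset_shift[of 0 A n B] by simp

lemma comparable_sym: "comparable e A B \<longleftrightarrow> comparable e B A"
proof -
  have "comparable e B A" if "comparable e A B" for A B
    unfolding comparable_def
  proof
    fix n
    show "shift (int e * n) B \<subseteq> A \<or> A \<subseteq> shift (int e * n) B"
      using that[unfolded comparable_def, rule_format, of "- n"] 
        subset_shift[of B "- (int e * n)" A] subset_shift[of A "int e * n" B] by auto
  qed
  then show ?thesis by blast
qed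

lemma comparable_shift_left: "comparable e (shift (int e * p) A) B \<longleftrightarrow> comparable e A B"
proof -
  have "comparable e (shift (int e * p) A) B" if "comparable e A B" for p A
    unfolding comparable_def
  proof
    fix n
    have "shift (int e * n) (shift (int e * p) A) = shift (int e * (n + p)) A" by (simp add: distrib_left)
    then show "shift (int e * n) (shift (int e * p) A) \<subseteq> B \<or> B \<subseteq> shift (int e * n) (shift (int e * p) A)"
      using that unfolding comparable_def by metis
  qed
  from this[of A p] this[of "shift (int e * p) A" "- p"] show ?thesis by auto
qed

lemma comparable_shift: "comparable e (shift (int e * p) A) (shift (int e * q) B) \<longleftrightarrow> comparable e A B"
  using comparable_shift_left comparable_sym by metis

text \<open>
  Comparable beta-sets are nested in the order of their charges, and comparable beta-sets of equal charge coincide.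
\<close>

lemma comparable_iff:
  assumes A: "is_beta_set A" and B: "is_beta_set B"
    and le: "charge A \<le> charge B" "charge B \<le> charge A + int e"
  shows "comparable e A B \<longleftrightarrow> A \<subseteq> B \<and> B \<subseteq> shift (int e) A"
proof
  assume c: "comparable e A B"
  have "A \<subseteq> B \<or> B \<subseteq> A" using c[unfolded comparable_def, rule_format, of 0] by simp
  then have 1: "A \<subseteq> B" using subset_charge_eq[OF B A] le by auto
  have sA: "is_beta_set (shift (int e) A)" "charge (shift (int e) A) = charge A + int e"
    using A charge_shift by auto
  have "shift (int e) A \<subseteq> B \<or> B \<subseteq> shift (int e) A" using c[unfolded comparable_def, rule_format, of 1] by simp
  then have "B \<subseteq> shift (int e) A" using subset_charge_eq[OF sA(1) B] le sA(2) by auto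
  with 1 show "A \<subseteq> B \<and> B \<subseteq> shift (int e) A" by blast
next
  assume sub: "A \<subseteq> B \<and> B \<subseteq> shift (int e) A"
  then have step: "A \<subseteq> shift (int e) A" by blast
  have up: "A \<subseteq> shift (int e * int n) A" for n
  proof (induction n)
    case (Suc n)
    have "shift (int e * int n) A \<subseteq> shift (int e * int n) (shift (int e) A)" using step by (rule shift_mono)
    then show ?case using Suc by (simp add: distrib_left add.commute)
  qed simp
  show "comparable e A B"
    unfolding comparable_def
  proof
    fix n :: int
    show "shift (int e * n) A \<subseteq> B \<or> B \<subseteq> shift (int e * n) A"
    proof (cases "n \<le> 0")
      case True
      then have "shift (int e * n) A \<subseteq> A" using up[of "nat (- n)"] unfolding subset_shift by simp
      then show ?thesis using sub by blast
    next
      case False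
      then have "shift (int e) A \<subseteq> shift (int e) (shift (int e * int (nat (n - 1))) A)"
        by (intro shift_mono up)
      also have "\<dots> = shift (int e * n) A" using False by (simp add: algebra_simps)
      finally show ?thesis using sub by blast
    qed
  qed
qed

text \<open>
  Reduce the charges modulo \<open>e\<close> and sort the residues.
\<close>

lemma ex_W_hat_A_bar:
  assumes e: "0 < e" and l: "0 < l"
  shows "\<exists>w\<in>W_hat l. act_charge e r w \<in> A_bar e l"
proof -
  define ys where "ys = map (\<lambda>i. r (Suc i) mod int e) [0..<l]"
  obtain p where p: "p permutes {..<l}" "permute_list p ys = sort ys"
    using mset_eq_permutation[of "sort ys" ys] by (auto simp: ys_def)
  define s where "s i = (if i \<in> {1..l} then Suc (p (i - 1)) else i)" for i
  have p_less: "p i < l" if "i < l" for i using permutes_in_image[OF p(1)] that by simp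
  have s: "s permutes {1..l}"
  proof (rule bij_imp_permutes)
    have inj: "inj_on s {1..l}"
    proof (rule inj_onI)
      fix i j assume "i \<in> {1..l}" "j \<in> {1..l}" "s i = s j"
      then have "p (i - 1) = p (j - 1)" "1 \<le> i" "1 \<le> j" by (auto simp: s_def)
      moreover from this(1) have "i - 1 = j - 1" by (rule injD[OF permutes_inj[OF p(1)]])
      ultimately show "i = j" by linarith
    qed
    have "s i \<in> {1..l}" if "i \<in> {1..l}" for i
      using p_less[of "i - 1"] that by (simp add: s_def Suc_le_eq) linarith
    then have "s ` {1..l} \<subseteq> {1..l}" by blast
    then show "bij_betw s {1..l} {1..l}" using inj endo_inj_surj[of "{1..l}" s] by (simp add: bij_betw_def)
  qed (auto simp: s_def)
  define v where "v = (\<lambda>i\<in>{1..l}. - (r (s i) div int e))"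
  have w: "(s, v) \<in> W_hat l" using s by (auto simp: W_hat_def v_def)
  have t: "act_charge e r (s, v) i = sort ys ! (i - 1)" if i: "i \<in> {1..l}" for i
  proof -
    have "act_charge e r (s, v) i = r (s i) mod int e"
      using i by (simp add: v_def minus_div_mult_eq_mod[symmetric] mult.commute)
    also have "\<dots> = ys ! p (i - 1)"
    proof -
      have "p (i - 1) < l" using i by (intro p_less) auto
      then show ?thesis using i by (simp add: ys_def s_def)
    qed
    also have "\<dots> = permute_list p ys ! (i - 1)"
      using i p(1) by (intro permute_list_nth[symmetric]) (auto simp: ys_def)
    also have "\<dots> = sort ys ! (i - 1)" by (simp only: p(2))
    finally show ?thesis .
  qed
  have "act_charge e r (s, v) \<in> A_bar e l"
    unfolding A_bar_def
  proof (intro CollectI conjI)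
    show "mono_on {1..l} (act_charge e r (s, v))"
    proof (rule mono_onI)
      fix i j assume ij: "i \<in> {1..l}" "j \<in> {1..l}" "i \<le> j"
      then have "sort ys ! (i - 1) \<le> sort ys ! (j - 1)" by (intro sorted_nth_mono) (auto simp: ys_def)
      then show "act_charge e r (s, v) i \<le> act_charge e r (s, v) j" using t ij by simp
    qed
    have "sort ys ! i \<in> {0..<int e}" if "i < l" for i
    proof -
      have "sort ys ! i \<in> set ys" using that nth_mem[of i "sort ys"] by (simp add: ys_def)
      then show ?thesis using e by (auto simp: ys_def)
    qed
    from this[of 0] this[of "l - 1"] show "act_charge e r (s, v) l \<le> act_charge e r (s, v) 1 + int e"
      using t[of l] t[of 1] l by simp
  qed
  then show ?thesis using w by blast
qed

text \<open>
  Moving a bead of \<open>U\<close> down by \<open>e\<close> takes it to the same place of the next strand.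
\<close>

lemma wt_eq_0_iff_strands:
  assumes e: "0 < e" and l: "0 < l" and U: "is_beta_set U"
  shows "wt e U = 0 \<longleftrightarrow> (\<forall>j\<in>{1..l}. strand e l U (int j) \<subseteq> strand e l U (int j + 1))"
  unfolding wt_eq_0_iff[OF e U]
proof (intro iffI ballI subsetI)
  fix j x assume "\<forall>x\<in>U. x - int e \<in> U" "x \<in> strand e l U (int j)"
  moreover have "position e l (int j) x - int e = position e l (int j + 1) x"
    using position_next[OF e l, of "int j + 1" x] by simp
  ultimately show "x \<in> strand e l U (int j + 1)" unfolding mem_strand by metis
next
  fix z assume sub: "\<forall>j\<in>{1..l}. strand e l U (int j) \<subseteq> strand e l U (int j + 1)" and z: "z \<in> U"
  obtain j x where j: "j \<in> {1..l}" and x: "z = position e l (int j) x"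
    using position_cover[OF e l] by blast
  have "x \<in> strand e l U (int j)" using z x by (simp add: mem_strand)
  then have "position e l (int j + 1) x \<in> U" using sub j mem_strand by blast
  then show "z - int e \<in> U" using position_next[OF e l, of "int j + 1" x] x by simp
qed

text \<open>
  For \<open>l = 2\<close> the weight vanishes iff \<open>Y\<^sub>1 \<subseteq> Y\<^sub>2 \<subseteq> Y\<^sub>3 = Y\<^sub>1 + e\<close>, and in the alcove this is comparability of
  \<open>Y\<^sub>1\<close> and \<open>Y\<^sub>2\<close>, which are translates of the two given beta-sets in some order.
\<close>

lemma edge_number_eq_0_iff:
  assumes e: "0 < e" and lam: "is_partition (lam i)" "is_partition (lam j)"
  shows "edge_number e r lam i j = 0 \<longleftrightarrow> comparable e (mbeta r lam i) (mbeta r lam j)"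
proof -
  define rr where "rr = pair_tuple (r i) (r j)"
  define la where "la = pair_tuple (lam i) (lam j)"
  define x where "x = (SOME x. x \<in> W_hat 2 \<and> act_charge e rr x \<in> A_bar e 2)"
  have "\<exists>x. x \<in> W_hat 2 \<and> act_charge e rr x \<in> A_bar e 2"
    using ex_W_hat_A_bar[OF e pos2, of rr] by blast
  then have "x \<in> W_hat 2 \<and> act_charge e rr x \<in> A_bar e 2"
    unfolding x_def by (rule someI_ex)
  then have x: "x \<in> W_hat 2" "act_charge e rr x \<in> A_bar e 2" by auto
  obtain s v where sv: "x = (s, v)" "s permutes {1..2}" using x(1) by (auto simp: W_hat_def)
  define X where "X = mbeta rr la"
  define Y where "Y = mbeta (\<lambda>k. rr (s k) + int e * v k) (\<lambda>k. la (s k))"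
  define U where "U = Uglov 2 e Y"
  have la: "is_multipartition 2 la" using lam by (auto simp: la_def pair_tuple_def is_multipartition_def)
  have la': "is_multipartition 2 (\<lambda>k. la (s k))" using is_multipartition_act[OF e _ la sv(2)] by simp
  have YB: "is_beta_set (Y k)" "charge (Y k) = rr (s k) + int e * v k" if "k \<in> {1..2}" for k
    unfolding Y_def using is_beta_set_mbeta[OF la' that] charge_mbeta[OF la' that] by auto
  have U: "is_beta_set U" unfolding U_def by (rule is_beta_set_Uglov[OF e _ YB(1)]) auto
  have st: "strand e 2 U 1 = Y 1" "strand e 2 U 2 = Y 2" "strand e 2 U 3 = shift (int e) (Y 1)"
    using strand_Uglov[OF e, of 2 1 Y] strand_Uglov[OF e, of 2 2 Y] strand_shift[OF e, of 2 U 1]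
    by (simp_all add: U_def)
  have "edge_number e r lam i j = wt e U"
    unfolding edge_number_def Let_def
    by (simp add: rr_def[symmetric] x_def[symmetric] la_def[symmetric] sv(1) mwt_def U_def Y_def)
  then have "edge_number e r lam i j = 0 \<longleftrightarrow> Y 1 \<subseteq> Y 2 \<and> Y 2 \<subseteq> shift (int e) (Y 1)"
    using wt_eq_0_iff_strands[OF e _ U, of 2] st by (simp add: numeral_2_eq_2 atLeastAtMostSuc_conv conj_commute)
  also have "\<dots> \<longleftrightarrow> comparable e (Y 1) (Y 2)"
  proof (rule comparable_iff[symmetric])
    have "mono_on {1..2::nat} (\<lambda>k. rr (s k) + int e * v k)"
        "rr (s 2) + int e * v 2 \<le> rr (s 1) + int e * v 1 + int e"
      using x(2) by (simp_all add: sv(1) A_bar_def)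
    then show "charge (Y 1) \<le> charge (Y 2)" "charge (Y 2) \<le> charge (Y 1) + int e"
      using YB(2) by (auto dest: mono_onD[of _ _ 1 2])
  qed (use YB(1) in auto)
  also have "\<dots> \<longleftrightarrow> comparable e (X (s 1)) (X (s 2))"
    unfolding Y_def X_def mbeta_act[OF e pos2] by (rule comparable_shift)
  also have "\<dots> \<longleftrightarrow> comparable e (X 1) (X 2)"
  proof -
    have s12: "s 1 \<in> {1, 2}" "s 2 \<in> {1, 2}" 
      using permutes_in_image[OF sv(2), of 1] permutes_in_image[OF sv(2), of 2] by auto
    have "s 1 \<noteq> s 2" using permutes_inj[OF sv(2)] by (metis injD numeral_eq_one_iff semiring_norm(85))
    then have "s 1 = 1 \<and> s 2 = 2 \<or> s 1 = 2 \<and> s 2 = 1" using s12 by auto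
    then show ?thesis using comparable_sym by auto
  qed
  finally show ?thesis by (simp add: X_def mbeta_def rr_def la_def pair_tuple_def)
qed

lemma not_connected_weight_graph_iff:
  assumes e: "0 < e" and l: "0 < l" and lam: "is_multipartition l lam"
  shows "\<not> connected (weight_graph l e r lam) \<longleftrightarrow>
    (\<exists>C. C \<subseteq> {1..l} \<and> C \<noteq> {} \<and> C \<noteq> {1..l} \<and>
      (\<forall>i\<in>C. \<forall>j\<in>{1..l} - C. comparable e (mbeta r lam i) (mbeta r lam j)))"
proof -
  let ?G = "weight_graph l e r lam"
  interpret wf_digraph ?G by unfold_locales (auto simp: weight_graph_def)
  have edge: "edge_number e r lam i j = 0 \<longleftrightarrow> comparable e (mbeta r lam i) (mbeta r lam j)"
    if "i \<in> {1..l}" "j \<in> {1..l}" for i j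
    using edge_number_eq_0_iff[OF e, of lam i j r] lam that by (simp add: is_multipartition_def)
  have "(\<forall>a\<in>arcs ?G. tail ?G a \<in> C \<longleftrightarrow> head ?G a \<in> C)
      \<longleftrightarrow> (\<forall>i\<in>C. \<forall>j\<in>{1..l} - C. comparable e (mbeta r lam i) (mbeta r lam j))" if C: "C \<subseteq> {1..l}" for C
  proof
    assume arcs: "\<forall>a\<in>arcs ?G. tail ?G a \<in> C \<longleftrightarrow> head ?G a \<in> C"
    have noedge: "edge_number e r lam i j = 0"
      if "i \<in> {1..l}" "j \<in> {1..l}" "i < j" "(i \<in> C) \<noteq> (j \<in> C)" for i j
    proof (rule ccontr)
      assume "edge_number e r lam i j \<noteq> 0"
      then have "(i, j, 0) \<in> arcs ?G" using that by (simp add: weight_graph_def)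
      then show False using arcs that(4) by (force simp: weight_graph_def)
    qed
    show "\<forall>i\<in>C. \<forall>j\<in>{1..l} - C. comparable e (mbeta r lam i) (mbeta r lam j)"
    proof (intro ballI)
      fix i j assume ij: "i \<in> C" "j \<in> {1..l} - C"
      then have mem: "i \<in> {1..l}" "j \<in> {1..l}" "i \<noteq> j" using C by auto
      show "comparable e (mbeta r lam i) (mbeta r lam j)"
      proof (cases "i < j")
        case True
        then show ?thesis using noedge[OF mem(1,2)] edge[OF mem(1,2)] ij by simp
      next
        case False
        then have "j < i" using mem by simp
        then show ?thesis using noedge[OF mem(2,1)] edge[OF mem(2,1)] ij comparable_sym by simp
      qed
    qed
  next
    assume comp: "\<forall>i\<in>C. \<forall>j\<in>{1..l} - C. comparable e (mbeta r lam i) (mbeta r lam j)"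
    show "\<forall>a\<in>arcs ?G. tail ?G a \<in> C \<longleftrightarrow> head ?G a \<in> C"
    proof
      fix a assume "a \<in> arcs ?G"
      then obtain i j k where a: "a = (i, j, k)" "1 \<le> i" "i < j" "j \<le> l" "k < edge_number e r lam i j"
        by (auto simp: weight_graph_def)
      then have mem: "i \<in> {1..l}" "j \<in> {1..l}" by auto
      have "\<not> comparable e (mbeta r lam i) (mbeta r lam j)" using edge[OF mem] a(5) by simp
      moreover from this have "\<not> comparable e (mbeta r lam j) (mbeta r lam i)" using comparable_sym by blast
      ultimately have "i \<in> C \<longleftrightarrow> j \<in> C" using comp mem by blast
      then show "tail ?G a \<in> C \<longleftrightarrow> head ?G a \<in> C" by (simp add: weight_graph_def a(1))
    qed
  qed
  then have "(C \<subseteq> {1..l} \<and> C \<noteq> {} \<and> C \<noteq> {1..l} \<and> (\<forall>a\<in>arcs ?G. tail ?G a \<in> C \<longleftrightarrow> head ?G a \<in> C))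
      \<longleftrightarrow> (C \<subseteq> {1..l} \<and> C \<noteq> {} \<and> C \<noteq> {1..l} \<and>
        (\<forall>i\<in>C. \<forall>j\<in>{1..l} - C. comparable e (mbeta r lam i) (mbeta r lam j)))" for C by blast
  moreover have V: "verts ?G = {1..l}" by (simp add: weight_graph_def)
  moreover have "verts ?G \<noteq> {}" using l unfolding V by simp
  ultimately show ?thesis unfolding not_connected_iff_cut[OF \<open>verts ?G \<noteq> {}\<close>] V by (simp only:)
qed

section \<open>Zeros of the moving vector\<close>

lemma strands_eqI:
  assumes e: "0 < e" and l: "0 < l"
    and eq: "\<And>j. j \<in> {1..l} \<Longrightarrow> strand e l U (int j) = strand e l V (int j)"
  shows "U = V"
proof (rule set_eqI)
  fix z
  obtain j x where j: "j \<in> {1..l}" and x: "z = position e l (int j) x"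
    using position_cover[OF e l] by blast
  then show "z \<in> U \<longleftrightarrow> z \<in> V" using eq[OF j] mem_strand by metis
qed

text \<open>
  A fixed \<open>(s, v) = w\<close> that moves the multicharge into the closed alcove.
\<close>

locale dominant_charge =
  fixes e l :: nat and r :: "nat \<Rightarrow> int" and lam :: "nat \<Rightarrow> nat \<Rightarrow> nat"
    and s :: "nat \<Rightarrow> nat" and v :: "nat \<Rightarrow> int"
  assumes e: "0 < e" and l: "0 < l"
    and lam: "is_multipartition l lam"
    and w: "(s, v) \<in> W_hat l"
    and dom: "act_charge e r (s, v) \<in> A_bar e l"
begin

definition t :: "nat \<Rightarrow> int" where "t j = r (s j) + int e * v j"

definition U :: "(nat \<Rightarrow> nat \<Rightarrow> nat) \<Rightarrow> int set" where
  "U mu = Uglov l e (mbeta t (\<lambda>j. mu (s j)))"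

lemma s: "s permutes {1..l}"
  using w by (simp add: W_hat_def)

lemma component_of:
  assumes "a \<in> {1..l}"
  obtains j where "j \<in> {1..l}" "a = s j"
proof -
  have "a \<in> s ` {1..l}" using assms unfolding permutes_image[OF s] .
  then show ?thesis using that by blast
qed

lemma t_eq: "(\<lambda>j. r (s j) + int e * v j) = t"
  by (simp add: t_def fun_eq_iff)

lemma act_eq: "act e (mu, r) (s, v) = (\<lambda>j. mu (s j), t)"
  by (simp add: t_eq)

lemma is_beta_set_U: "is_multipartition l mu \<Longrightarrow> is_beta_set (U mu)"
  unfolding U_def
  by (rule is_beta_set_Uglov[OF e l]) (rule is_beta_set_mbeta[OF is_multipartition_act[OF e l _ s]])

lemma strand_U: "j \<in> {1..l} \<Longrightarrow> strand e l (U mu) (int j) = mbeta t (\<lambda>j. mu (s j)) j"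
  unfolding U_def by (rule strand_Uglov[OF e l])

lemma charge_strand_U:
  "is_multipartition l mu \<Longrightarrow> j \<in> {1..l} \<Longrightarrow> charge (strand e l (U mu) (int j)) = t j"
  unfolding strand_U by (rule charge_mbeta[OF is_multipartition_act[OF e l _ s]])

lemma mv_eq_0_iff:
  assumes mu: "is_multipartition l mu" and i: "i \<in> {1..l}"
  shows "mv l e (act e (mu, r) (s, v)) i = 0 \<longleftrightarrow> separated e l (U mu) (int i)"
proof -
  have "mv l e (act e (mu, r) (s, v)) i = 0
      \<longleftrightarrow> rsum (cut_level e l (int i)) (U mu) = rsum (cut_level e l (int i)) (core e (U mu))"
    using mv_eq[OF e l is_multipartition_act[OF e l mu s] i, of t]
    unfolding act_eq U_def[symmetric] by (intro iffI) linarith+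
  then show ?thesis
    unfolding no_moves_iff[OF e l is_beta_set_U[OF mu]] .
qed

text \<open>
  Inside a period this is the monotonicity of \<open>t\<close>, and from strand \<open>l\<close> to strand \<open>l + 1\<close> it is the
  inequality \<open>t\<^sub>l \<le> t\<^sub>1 + e\<close>.
\<close>

lemma charge_strand_step:
  assumes mu: "is_multipartition l mu"
  shows "charge (strand e l (U mu) j) \<le> charge (strand e l (U mu) (j + 1))"
proof -
  note B = is_beta_set_U[OF mu]
  have mono: "mono_on {1..l} t" and top: "t l \<le> t 1 + int e"
    using dom by (simp_all add: A_bar_def t_eq)
  obtain k n where k: "k \<in> {1..l}" "j = int k + n * int l" by (rule int_window[OF e l])
  have 1: "charge (strand e l (U mu) j) = t k + n * int e"
    using charge_strand_shift[OF e l B, of "int k" n] charge_strand_U[OF mu k(1)] k(2) by simp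
  show ?thesis
  proof (cases "k = l")
    case True
    have j1: "j + 1 = int 1 + (n + 1) * int l" using k(2) True by (simp add: distrib_right)
    have "charge (strand e l (U mu) (j + 1)) = t 1 + (n + 1) * int e"
      unfolding j1
      using charge_strand_shift[OF e l B, of "int 1" "n + 1"] charge_strand_U[OF mu, of 1] l by simp
    then show ?thesis using 1 top True by (simp add: distrib_right)
  next
    case False
    then have k': "k + 1 \<in> {1..l}" using k(1) by simp
    have j1: "j + 1 = int (k + 1) + n * int l" using k(2) by simp
    have "charge (strand e l (U mu) (j + 1)) = t (k + 1) + n * int e"
      unfolding j1
      using charge_strand_shift[OF e l B, of "int (k + 1)" n] charge_strand_U[OF mu k'] by simp
    then show ?thesis using 1 mono_onD[OF mono k(1) k'] by simp
  qed
qed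

lemma charge_strand_mono:
  assumes mu: "is_multipartition l mu" and le: "j \<le> k"
  shows "charge (strand e l (U mu) j) \<le> charge (strand e l (U mu) k)"
  using le
proof (induction k rule: int_ge_induct)
  case (step k)
  then show ?case using charge_strand_step[OF mu, of k] by linarith
qed simp

text \<open>
  The component of \<open>lam\<close> of which strand \<open>i\<close> is a translate.
\<close>

definition vertex :: "int \<Rightarrow> nat" where
  "vertex i = s (nat ((i - 1) mod int l) + 1)"

lemma vertex_window:
  assumes "j \<in> {1..l}"
  shows "vertex (int j + n * int l) = s j"
proof -
  have eq: "int j + n * int l - 1 = n * int l + (int j - 1)" by simp
  have "(int j + n * int l - 1) mod int l = int j - 1" unfolding eq by (rule runner_div_mod(2)[OF assms])
  then show ?thesis using assms by (simp add: vertex_def nat_diff_distrib)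
qed

lemma vertex_mem: "vertex i \<in> {1..l}"
proof -
  obtain j n where j: "j \<in> {1..l}" "i = int j + n * int l" by (rule int_window[OF e l])
  then show ?thesis using vertex_window[OF j(1), of n] permutes_in_image[OF s] by simp
qed

lemma vertex_surj:
  assumes "a \<in> {1..l}"
  obtains i where "i0 < i" "i \<le> i0 + int l" "vertex i = a"
proof -
  obtain j where j: "j \<in> {1..l}" "a = s j" using component_of assms by blast
  define q where "q = (i0 - int j) div int l + 1"
  have "(q - 1) * int l \<le> i0 - int j" "i0 - int j < q * int l"
  proof -
    have "i0 - int j = (q - 1) * int l + (i0 - int j) mod int l" by (simp add: q_def)
    moreover have "0 \<le> (i0 - int j) mod int l" "(i0 - int j) mod int l < int l" using l by simp_all
    ultimately show "(q - 1) * int l \<le> i0 - int j" "i0 - int j < q * int l"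
      unfolding left_diff_distrib by linarith+
  qed
  then have "i0 < int j + q * int l" "int j + q * int l \<le> i0 + int l"
    unfolding left_diff_distrib by linarith+
  then show ?thesis using that vertex_window[OF j(1), of q] j(2) by blast
qed

lemma comparable_vertex:
  "comparable e (mbeta r mu (vertex i)) (mbeta r mu (vertex k))
    \<longleftrightarrow> comparable e (strand e l (U mu) i) (strand e l (U mu) k)"
proof -
  have "\<exists>n. strand e l (U mu) i = shift (int e * n) (mbeta r mu (vertex i))" for i
  proof -
    obtain j n where j: "j \<in> {1..l}" "i = int j + n * int l" by (rule int_window[OF e l])
    have "strand e l (U mu) i = shift (n * int e) (shift (int e * v j) (mbeta r mu (s j)))"
      unfolding j(2) strand_shift_mult[OF e l] strand_U[OF j(1)] t_eq[symmetric] mbeta_act[OF e l] ..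
    also have "\<dots> = shift (int e * (n + v j)) (mbeta r mu (vertex i))"
      by (simp add: j(2) vertex_window[OF j(1)] algebra_simps)
    finally show ?thesis by blast
  qed
  then obtain m n where "strand e l (U mu) i = shift (int e * m) (mbeta r mu (vertex i))"
      "strand e l (U mu) k = shift (int e * n) (mbeta r mu (vertex k))" by blast
  then show ?thesis by (simp add: comparable_shift)
qed

lemma comparable_strands_iff:
  assumes ij: "i < j" "j < i + int l"
  shows "comparable e (strand e l (U lam) i) (strand e l (U lam) j)
    \<longleftrightarrow> strand e l (U lam) i \<subseteq> strand e l (U lam) j \<and> strand e l (U lam) j \<subseteq> strand e l (U lam) (i + int l)"
  unfolding strand_shift[OF e l]
proof (rule comparable_iff)
  note B = is_beta_set_U[OF lam]
  show "charge (strand e l (U lam) i) \<le> charge (strand e l (U lam) j)"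
    using ij by (intro charge_strand_mono lam) simp
  have "charge (strand e l (U lam) j) \<le> charge (strand e l (U lam) (i + 1 * int l))"
    using ij by (intro charge_strand_mono lam) simp
  then show "charge (strand e l (U lam) j) \<le> charge (strand e l (U lam) i) + int e"
    unfolding charge_strand_shift[OF e l B] by simp
qed (intro is_beta_set_strand[OF e l is_beta_set_U[OF lam]])+

lemma separated_period: "separated e l (U mu) (i + int l) \<longleftrightarrow> separated e l (U mu) i"
proof -
  have step: "strand e l (U mu) (j + int l) \<subseteq> strand e l (U mu) (k + int l)
      \<longleftrightarrow> strand e l (U mu) j \<subseteq> strand e l (U mu) k" for j k
    unfolding strand_shift[OF e l] shift_subset_shift by simp
  show ?thesis
    unfolding separated_def
  proof (intro iffI allI impI)
    fix j k assume a: "\<forall>j k. j \<le> i + int l \<and> i + int l < k \<longrightarrow> strand e l (U mu) j \<subseteq> strand e l (U mu) k" "j \<le> i \<and> i < k"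
    then show "strand e l (U mu) j \<subseteq> strand e l (U mu) k" using step[of j k] by simp
  next
    fix j k assume a: "\<forall>j k. j \<le> i \<and> i < k \<longrightarrow> strand e l (U mu) j \<subseteq> strand e l (U mu) k" "j \<le> i + int l \<and> i + int l < k"
    then have "strand e l (U mu) (j - int l) \<subseteq> strand e l (U mu) (k - int l)" by simp
    then show "strand e l (U mu) j \<subseteq> strand e l (U mu) k" using step[of "j - int l" "k - int l"] by simp
  qed
qed

text \<open>
  The vertices carried by the strands \<open>i + 1, \<dots>, j\<close> have no edge to the others: for a strand \<open>p\<close> of this range
  and a strand \<open>q\<close> outside it, one of the two cuts lies between \<open>p\<close> and \<open>q\<close>, and the other one or
  its translate by \<open>l\<close> lies between the later of them and the next translate of the earlier.
\<close>

lemma two_separated_imp_disconnected: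
  assumes i: "i \<in> {1..l}" and j: "j \<in> {1..l}" and ij: "i < j"
    and sep: "separated e l (U lam) (int i)" "separated e l (U lam) (int j)"
  shows "\<not> connected (weight_graph l e r lam)"
proof -
  let ?S = "strand e l (U lam)"
  define C where "C = s ` {i + 1..j}"
  have inj: "inj s" using permutes_inj[OF s] .
  have "C \<subseteq> s ` {1..l}" unfolding C_def using i j by (intro image_mono) auto
  then have sub: "C \<subseteq> {1..l}" unfolding permutes_image[OF s] .
  have "s j \<in> C" using ij by (simp add: C_def)
  moreover have "s i \<in> {1..l}" using i permutes_in_image[OF s] by blast
  moreover have "s i \<notin> C"
  proof
    assume "s i \<in> C"
    then obtain q where "q \<in> {i + 1..j}" "s i = s q" unfolding C_def by blast
    then show False using injD[OF inj, of i q] by simp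
  qed
  moreover have "comparable e (mbeta r lam a) (mbeta r lam b)" if a: "a \<in> C" and b: "b \<in> {1..l} - C" for a b
  proof -
    obtain p where p: "p \<in> {i + 1..j}" "a = s p" using a by (auto simp: C_def)
    obtain q where q: "q \<in> {1..l}" "b = s q" using b component_of by blast
    then have q': "q \<notin> {i + 1..j}" using b by (auto simp: C_def)
    have p': "p \<in> {1..l}" using p i j by auto
    have verts: "a = vertex (int p)" "b = vertex (int q)"
      using vertex_window[OF p', of 0] vertex_window[OF q(1), of 0] p(2) q(2) by simp_all
    have "comparable e (?S (int p)) (?S (int q))"
    proof (cases "q \<le> i")
      case True
      have "?S (int q) \<subseteq> ?S (int p)"
        using p True by (intro separatedD[OF sep(1)]) auto
      moreover have "?S (int p) \<subseteq> ?S (int q + int l)"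
        using p j q by (intro separatedD[OF sep(2)]) auto
      ultimately have "comparable e (?S (int q)) (?S (int p))"
        using comparable_strands_iff[of "int q" "int p"] p True p' q by auto
      then show ?thesis using comparable_sym by blast
    next
      case False
      then have "j < q" using q' by auto
      have "?S (int p) \<subseteq> ?S (int q)"
        using p \<open>j < q\<close> by (intro separatedD[OF sep(2)]) auto
      moreover have "?S (int q) \<subseteq> ?S (int p + int l)"
        using separatedD[of e l "U lam" "int i + int l" "int q" "int p + int l"]
          separated_period sep(1) p q i by auto
      ultimately show ?thesis
        using comparable_strands_iff[of "int p" "int q"] p \<open>j < q\<close> q by auto
    qed
    then show ?thesis using comparable_vertex verts by simp
  qed
  ultimately show ?thesis
    unfolding not_connected_weight_graph_iff[OF e l lam] using sub by (intro exI[of _ C]) blast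
qed

text \<open>
  Let \<open>t\<close> be the first index after \<open>i0\<close> whose vertex lies on the other side of the partition from the vertex of
  \<open>i0 + 1\<close>.  If \<open>X\<^sub>j \<subseteq> X\<^sub>k\<close> fails for some \<open>j < t \<le> k\<close>, then \<open>j\<close> and \<open>k\<close> lie in the window from \<open>i0 + 1\<close> to
  \<open>i0 + l\<close>, because the cuts at \<open>i0\<close> and \<open>i0 + l\<close> are separated.  The failure is an edge, so \<open>k\<close> is on the
  side of \<open>j\<close>, and \<open>t\<close>, being on the other side, gives \<open>X\<^sub>j \<subseteq> X\<^sub>t \<subseteq> X\<^sub>k\<close>.
\<close>

lemma disconnected_imp_two_separated:
  assumes sep: "separated e l (U lam) i0"
    and disc: "\<not> connected (weight_graph l e r lam)"
  obtains i where "i0 < i" "i < i0 + int l" "separated e l (U lam) i"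
proof -
  let ?S = "strand e l (U lam)"
  obtain C0 where C0: "C0 \<subseteq> {1..l}" "C0 \<noteq> {}" "C0 \<noteq> {1..l}"
      "\<forall>i\<in>C0. \<forall>j\<in>{1..l} - C0. comparable e (mbeta r lam i) (mbeta r lam j)"
    using disc unfolding not_connected_weight_graph_iff[OF e l lam] by blast
  \<comment> \<open>the partition is symmetric, so the side that contains the vertex of \<open>i0 + 1\<close> may be chosen\<close>
  define C where "C = (if vertex (i0 + 1) \<in> C0 then C0 else {1..l} - C0)"
  have C: "vertex (i0 + 1) \<in> C" "C \<noteq> {1..l}" "C \<subseteq> {1..l}"
    using vertex_mem C0 by (auto simp: C_def)
  have comp: "comparable e (mbeta r lam a) (mbeta r lam b)" if "a \<in> C" "b \<in> {1..l} - C" for a b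
  proof (cases "vertex (i0 + 1) \<in> C0")
    case True
    then show ?thesis using that C0(4) by (simp add: C_def)
  next
    case False
    then have "a \<in> {1..l} - C0" "b \<in> C0" using that by (auto simp: C_def)
    then show ?thesis using C0(4) comparable_sym by blast
  qed
  obtain b where b: "b \<in> {1..l}" "b \<notin> C" using C by blast
  obtain i1 where i1: "i0 < i1" "i1 \<le> i0 + int l" "vertex i1 = b" using vertex_surj[OF b(1)] by blast
  define n where "n = (LEAST n. vertex (i0 + int n) \<notin> C \<and> 0 < n)"
  have ex: "vertex (i0 + int (nat (i1 - i0))) \<notin> C \<and> 0 < nat (i1 - i0)" using i1 b(2) by simp
  have n: "vertex (i0 + int n) \<notin> C" "0 < n"
    using LeastI[of "\<lambda>n. vertex (i0 + int n) \<notin> C \<and> 0 < n", OF ex] unfolding n_def by auto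
  have "n \<le> nat (i1 - i0)" unfolding n_def using ex by (rule Least_le)
  then have nl: "n \<le> l" using i1 by linarith
  have before: "vertex (i0 + int m) \<in> C" if "0 < m" "m < n" for m
    using not_less_Least[of m "\<lambda>n. vertex (i0 + int n) \<notin> C \<and> 0 < n"] that unfolding n_def by blast
  have n1: "n \<noteq> 1" using n C(1) by auto
  define t where "t = i0 + int n"
  have "separated e l (U lam) (t - 1)"
    unfolding separated_def
  proof (intro allI impI, rule ccontr)
    fix j k assume jk: "j \<le> t - 1 \<and> t - 1 < k" and nsub: "\<not> ?S j \<subseteq> ?S k"
    have "i0 < j"
      using separatedD[OF sep, of j k] nsub jk n(2) by (force simp: t_def)
    have "k \<le> i0 + int l"
      using separatedD[of e l "U lam" "i0 + int l" j k] separated_period[of lam i0] sep nsub jk nl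
      by (force simp: t_def)
    have vj: "vertex j \<in> C"
    proof -
      have "0 < nat (j - i0)" "nat (j - i0) < n" "i0 + int (nat (j - i0)) = j"
        using \<open>i0 < j\<close> jk by (auto simp: t_def)
      then show ?thesis using before[of "nat (j - i0)"] by simp
    qed
    have vt: "vertex t \<in> {1..l} - C" using n(1) vertex_mem by (simp add: t_def)
    have "\<not> comparable e (?S j) (?S k)"
      using comparable_strands_iff[of j k] nsub jk \<open>i0 < j\<close> \<open>k \<le> i0 + int l\<close> by auto
    then have "\<not> comparable e (mbeta r lam (vertex j)) (mbeta r lam (vertex k))"
      using comparable_vertex by blast
    then have vk: "vertex k \<in> C" using comp[OF vj] vertex_mem[of k] by blast
    then have "t < k" using vt jk by (cases "k = t") auto
    have "comparable e (?S j) (?S t)" using comp[OF vj vt] comparable_vertex by blast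
    then have 1: "?S j \<subseteq> ?S t"
      using comparable_strands_iff[of j t] jk \<open>i0 < j\<close> nl by (auto simp: t_def)
    have "comparable e (?S t) (?S k)" using comp[OF vk vt] comparable_vertex comparable_sym by blast
    then have "?S t \<subseteq> ?S k"
      using comparable_strands_iff[of t k] \<open>t < k\<close> \<open>k \<le> i0 + int l\<close> n(2) by (auto simp: t_def)
    with 1 nsub show False by blast
  qed
  moreover have "i0 < t - 1" "t - 1 < i0 + int l" using n(2) n1 nl by (auto simp: t_def)
  ultimately show ?thesis using that by blast
qed

text \<open>
  Both sides say that core and weight agree at \<open>w\<close>: the left one by invariants of the given multicharge, the
  right one by the runner charges and the moves, which are what \<open>no_moves_iff\<close> and \<open>ex_noncore\<close> speak about.
\<close>

lemma core_wt_U_iff: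
  assumes mu: "is_multipartition l mu" and nu: "is_multipartition l nu"
  shows "(\<forall>c\<in>{1..e}. quot_charge e l (mbeta r mu) c = quot_charge e l (mbeta r nu) c)
      \<and> row_sum e l (mbeta r mu) = row_sum e l (mbeta r nu)
    \<longleftrightarrow> (\<forall>c\<in>{1..e}. charge (quot e (U mu) c) = charge (quot e (U nu) c))
      \<and> (\<forall>i. rsum (cut_level e l i) (U mu) = rsum (cut_level e l i) (U nu))"
proof -
  have q: "charge (quot e (U mu) c) = quot_charge e l (mbeta t (\<lambda>j. mu (s j))) c"
    if "is_multipartition l mu" "c \<in> {1..e}" for mu c
    by (rule charge_quot_eq_quot_charge[OF e l is_beta_set_U[OF that(1)] strand_U that(2)])
  have c: "rsum (cut_level e l i) (U mu) = row_sum e l (mbeta t (\<lambda>j. mu (s j)))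
      + (\<Sum>j=1..l. ((int l - int j + i) div int l) * t j)" if "is_multipartition l mu" for mu i
    using rsum_cut[OF e l is_beta_set_U[OF that] strand_U, of i]
      charge_mbeta[OF is_multipartition_act[OF e l that s], of _ t] by simp
  show ?thesis
    using core_wt_act_eq_iff[OF e l nu mu w, of r]
      core_wt_eq_iff[OF e l is_multipartition_act[OF e l nu s] is_multipartition_act[OF e l mu s], of t]
    unfolding act_eq case_prod_conv by (simp add: q[OF mu] q[OF nu] c[OF mu] c[OF nu])
qed

text \<open>
  The block is defined by a condition for all admissible \<open>w\<close>; as the invariants do not depend on \<open>w\<close>, the
  condition for the fixed one is enough.
\<close>

lemma mem_block_iff:
  "mu \<in> block l e r lam \<longleftrightarrow> is_multipartition l mu
      \<and> (\<forall>c\<in>{1..e}. charge (quot e (U mu) c) = charge (quot e (U lam) c))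
      \<and> (\<forall>i. rsum (cut_level e l i) (U mu) = rsum (cut_level e l i) (U lam))"
proof (cases "is_multipartition l mu")
  case True
  have "mu \<in> block l e r lam \<longleftrightarrow>
      (\<forall>c\<in>{1..e}. quot_charge e l (mbeta r mu) c = quot_charge e l (mbeta r lam) c)
      \<and> row_sum e l (mbeta r mu) = row_sum e l (mbeta r lam)"
    using core_wt_act_eq_iff[OF e l lam True, of _ r] True w dom unfolding block_def by blast
  then show ?thesis using core_wt_U_iff[OF True lam] True by blast
qed (simp add: block_def)

text \<open>
  All members of the block have the same moves across the cut \<open>i\<close>.  If there are none, then
  \<open>X\<^sub>j \<subseteq> X\<^bsub>j+l\<^esub> = X\<^sub>j + e\<close>, because the cut \<open>i\<close> or its translate \<open>i + l\<close> lies between \<open>j\<close> and \<open>j + l\<close>.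
\<close>

lemma separated_imp_core_block:
  assumes i: "i \<in> {1..l}" and sep: "separated e l (U lam) (int i)"
  shows "is_core_block l e (block l e r lam)"
  unfolding is_core_block_def
proof (intro ballI)
  fix mu a assume mu: "mu \<in> block l e r lam" and a: "a \<in> {1..l}"
  have mp: "is_multipartition l mu" using mu mem_block_iff by blast
  have "core e (U mu) = core e (U lam)"
    using mu mem_block_iff by (intro core_eqI[OF e is_beta_set_U[OF mp] is_beta_set_U[OF lam]]) blast
  moreover have "rsum (cut_level e l (int i)) (U mu) = rsum (cut_level e l (int i)) (U lam)" using mu mem_block_iff by blast
  ultimately have sep': "separated e l (U mu) (int i)"
    using sep no_moves_iff[OF e l is_beta_set_U[OF mp], of "int i"]
      no_moves_iff[OF e l is_beta_set_U[OF lam], of "int i"] by simp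
  obtain j where j: "j \<in> {1..l}" "a = s j" using a component_of by blast
  have "strand e l (U mu) (int j) \<subseteq> shift (int e) (strand e l (U mu) (int j))"
  proof (cases "j \<le> i")
    case True
    then have "strand e l (U mu) (int j) \<subseteq> strand e l (U mu) (int j + int l)"
      using i j(1) by (intro separatedD[OF sep']) auto
    then show ?thesis unfolding strand_shift[OF e l] .
  next
    case False
    then have "strand e l (U mu) (int j) \<subseteq> strand e l (U mu) (int j + int l)"
      using separatedD[of e l "U mu" "int i + int l" "int j" "int j + int l"] separated_period[of mu "int i"]
        sep' j(1) i by auto
    then show ?thesis unfolding strand_shift[OF e l] .
  qed
  then have "\<forall>x\<in>beta (t j) (mu a). x - int e \<in> beta (t j) (mu a)"
    unfolding strand_U[OF j(1)] mbeta_def j(2) by auto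
  moreover have "is_partition (mu a)" using mp a by (simp add: is_multipartition_def)
  ultimately show "wt_partition e (mu a) = 0" using wt_partition_eq_0_iff[OF e] by blast
qed

lemma core_block_imp_separated:
  assumes core: "is_core_block l e (block l e r lam)"
  obtains i where "i \<in> {1..l}" "separated e l (U lam) (int i)"
proof -
  have "\<exists>i\<in>{1..l}. separated e l (U lam) (int i)"
  proof (rule ccontr)
    assume none: "\<not> (\<exists>i\<in>{1..l}. separated e l (U lam) (int i))"
    note B = is_beta_set_U[OF lam]
    have "rsum (cut_level e l (int i)) (U lam) \<noteq> rsum (cut_level e l (int i)) (core e (U lam))" if "i \<in> {1..l}" for i
      using none that no_moves_iff[OF e l B, of "int i"] by blast
    then obtain V j x where V: "is_beta_set V"
      and quotV: "\<forall>c\<in>{1..e}. charge (quot e V c) = charge (quot e (U lam) c)"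
      and cutV: "\<forall>i. rsum (cut_level e l i) V = rsum (cut_level e l i) (U lam)"
      and j: "j \<in> {1..l}" and x: "x + int e \<in> strand e l V (int j)" "x \<notin> strand e l V (int j)"
      using ex_noncore[OF e l B charge_strand_step[OF lam]] by blast
    define mu where "mu a = beta_inv (strand e l V (int (inv s a)))" for a
    have mu_s: "mu (s k) = beta_inv (strand e l V (int k))" for k
      using permutes_inj[OF s] by (simp add: mu_def inv_f_f)
    note SV = is_beta_set_strand[OF e l V]
    have mp: "is_multipartition l mu"
      unfolding is_multipartition_def mu_def using is_partition_beta_inv[OF SV] by blast
    have charge_SV: "charge (strand e l V (int k)) = t k" if "k \<in> {1..l}" for k
      using charge_strand_diff[OF e l V B, of "int k"] cutV charge_strand_U[OF lam that] by simp
    have beta_mu: "beta (t k) (mu (s k)) = strand e l V (int k)" if "k \<in> {1..l}" for k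
      using beta_beta_inv[OF SV, of "int k"] charge_SV[OF that] by (simp add: mu_s)
    have "strand e l (U mu) (int k) = strand e l V (int k)" if "k \<in> {1..l}" for k
      using strand_U[OF that, of mu] beta_mu[OF that] by (simp add: mbeta_def)
    then have UV: "U mu = V" by (rule strands_eqI[OF e l])
    then have "mu \<in> block l e r lam" using mem_block_iff mp quotV cutV by simp
    moreover have "s j \<in> {1..l}" using j permutes_in_image[OF s] by blast
    ultimately have "wt_partition e (mu (s j)) = 0" using core unfolding is_core_block_def by blast
    moreover have "is_partition (mu (s j))" using mp \<open>s j \<in> {1..l}\<close> by (simp add: is_multipartition_def)
    ultimately have "\<forall>y\<in>strand e l V (int j). y - int e \<in> strand e l V (int j)"
      using wt_partition_eq_0_iff[OF e, of "mu (s j)" "t j"] beta_mu[OF j] by simp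
    then show False using x by force
  qed
  then show ?thesis using that by blast
qed

lemma decomposable_imp_two_zeros:
  assumes "decomposable l e r lam"
  shows "\<exists>i\<in>{1..l}. \<exists>j\<in>{1..l}. i \<noteq> j \<and>
    mv l e (act e (lam, r) (s, v)) i = 0 \<and> mv l e (act e (lam, r) (s, v)) j = 0"
proof -
  obtain i where i: "i \<in> {1..l}" "separated e l (U lam) (int i)"
    using assms core_block_imp_separated unfolding decomposable_def by blast
  obtain k where k: "int i < k" "k < int i + int l" "separated e l (U lam) k"
    using disconnected_imp_two_separated[OF i(2)] assms unfolding decomposable_def by blast
  have "\<exists>j\<in>{1..l}. j \<noteq> i \<and> separated e l (U lam) (int j)"
  proof (cases "k \<le> int l")
    case True
    then have "nat k \<in> {1..l}" "nat k \<noteq> i" "int (nat k) = k" using k(1) i(1) by auto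
    then show ?thesis using k(3) by metis
  next
    case False
    then have "nat (k - int l) \<in> {1..l}" "nat (k - int l) \<noteq> i" "int (nat (k - int l)) = k - int l"
      using k(2) i(1) by auto
    then show ?thesis using k(3) separated_period[of lam "k - int l"] by (metis diff_add_cancel)
  qed
  then show ?thesis using i mv_eq_0_iff[OF lam] by blast
qed

lemma two_zeros_imp_decomposable:
  assumes i: "i \<in> {1..l}" and j: "j \<in> {1..l}" and ne: "i \<noteq> j"
    and zero: "mv l e (act e (lam, r) (s, v)) i = 0" "mv l e (act e (lam, r) (s, v)) j = 0"
  shows "decomposable l e r lam"
proof -
  have sep: "separated e l (U lam) (int i)" "separated e l (U lam) (int j)"
    using zero mv_eq_0_iff[OF lam i] mv_eq_0_iff[OF lam j] by auto
  have "\<not> connected (weight_graph l e r lam)"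
  proof (cases "i < j")
    case True
    then show ?thesis by (rule two_separated_imp_disconnected[OF i j _ sep])
  next
    case False
    then have "j < i" using ne by simp
    then show ?thesis by (rule two_separated_imp_disconnected[OF j i _ sep(2,1)])
  qed
  then show ?thesis using separated_imp_core_block[OF i sep(1)] unfolding decomposable_def by blast
qed

end

theorem corollary3p22:
  fixes e l :: nat and r :: "nat \<Rightarrow> int" and lam :: "nat \<Rightarrow> nat \<Rightarrow> nat"
  assumes "2 \<le> e" and "1 \<le> l" and "is_multipartition l lam"
  shows "(decomposable l e r lam \<longleftrightarrow>
            (\<exists>w\<in>W_hat l. act_charge e r w \<in> A_bar e l \<and>
               (\<exists>i\<in>{1..l}. \<exists>j\<in>{1..l}. i \<noteq> j \<and>
                  mv l e (act e (lam, r) w) i = 0 \<and> mv l e (act e (lam, r) w) j = 0)))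
       \<and> (decomposable l e r lam \<longleftrightarrow>
            (\<forall>w\<in>W_hat l. act_charge e r w \<in> A_bar e l \<longrightarrow>
               (\<exists>i\<in>{1..l}. \<exists>j\<in>{1..l}. i \<noteq> j \<and>
                  mv l e (act e (lam, r) w) i = 0 \<and> mv l e (act e (lam, r) w) j = 0)))"
    (is "(_ \<longleftrightarrow> (\<exists>w\<in>_. ?dom w \<and> ?zeros w)) \<and> _")
proof -
  have e: "0 < e" and l: "0 < l" using assms by auto
  have iff: "decomposable l e r lam \<longleftrightarrow> ?zeros w" if "w \<in> W_hat l" "?dom w" for w
  proof -
    obtain s v where sv: "w = (s, v)" by (cases w)
    have "(s, v) \<in> W_hat l" "act_charge e r (s, v) \<in> A_bar e l" using that unfolding sv by blast+
    then interpret dominant_charge e l r lam s v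
      by (intro dominant_charge.intro e l assms(3))
    show ?thesis
      unfolding sv
    proof
      assume "decomposable l e r lam"
      then show "?zeros (s, v)" by (rule decomposable_imp_two_zeros)
    next
      assume "?zeros (s, v)"
      then show "decomposable l e r lam" using two_zeros_imp_decomposable by blast
    qed
  qed
  obtain w where "w \<in> W_hat l" "?dom w" using ex_W_hat_A_bar[OF e l] by blast
  then show ?thesis using iff by (intro conjI) blast+
qed

end
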